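(* For every infinite sequence of primes $\Pi=(p_1,p_2,\ldots)$ (not necessarily distinct), there exists a finitely generated torsion non-amenable $\Pi$-graded group $G$. In particular, for every prime $p$, there exists a finitely generated residually finite non-amenable $p$-group.
   Context: Given a sequence of primes $\Pi=(p_i)_{i\ge 1}$, a $\Pi$-series in a group $G$ is a chain of normal subgroups $G=G_0\rhd G_1\rhd\cdots$ of $G$ such that for each $i\ge 1$ the quotient $G_{i-1}/G_i$ is either trivial or abelian of exponent $p_i$. (Successive terms may coincide.) A group $G$ is $\Pi$-graded if it admits a $\Pi$-series $\{G_i\}$ with $\bigcap_i G_i=\{1\}$. A group is torsion if each of its elements has finite order. A $p$-group is a (possibly infinite) group in which every element has order a power of $p$. *)

theory Defs
  imports "HOL-Algebra.Algebra" "HOL-Computational_Algebra.Primes"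
begin

text \<open>Such groups are countable, so up to isomorphism all of them have a carrier contained in the
  type of natural numbers.\<close>

definition finitely_generated_group :: "('a, 'b) monoid_scheme \<Rightarrow> bool" where
  "finitely_generated_group G \<longleftrightarrow>
     group G \<and> (\<exists>S. finite S \<and> S \<subseteq> carrier G \<and> generate G S = carrier G)"

definition torsion_group :: "('a, 'b) monoid_scheme \<Rightarrow> bool" where
  "torsion_group G \<longleftrightarrow>
     group G \<and> (\<forall>x\<in>carrier G. \<exists>n::nat. n > 0 \<and> x [^]\<^bsub>G\<^esub> n = \<one>\<^bsub>G\<^esub>)"

text \<open>\<^const>\<open>group.ord\<close> is \<open>0\<close> on elements of infinite order, so \<open>G\<close> is in particular
  torsion when \<open>p\<close> is prime.\<close>

definition p_group :: "nat \<Rightarrow> ('a, 'b) monoid_scheme \<Rightarrow> bool" where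
  "p_group p G \<longleftrightarrow> group G \<and> (\<forall>x\<in>carrier G. \<exists>k::nat. group.ord G x = p ^ k)"

definition residually_finite_group :: "('a, 'b) monoid_scheme \<Rightarrow> bool" where
  "residually_finite_group G \<longleftrightarrow>
     group G \<and>
     (\<forall>x\<in>carrier G - {\<one>\<^bsub>G\<^esub>}. \<exists>N. N \<lhd> G \<and> finite (carrier (G Mod N)) \<and> x \<notin> N)"

text \<open>Amenability of \<open>G\<close> as a discrete group, in von Neumann's sense: there is a left-invariant
  finitely additive probability measure on all subsets of \<open>G\<close>. The values of \<open>\<mu>\<close> on sets not
  contained in the carrier are irrelevant.\<close>

definition amenable_group :: "('a, 'b) monoid_scheme \<Rightarrow> bool" where
  "amenable_group G \<longleftrightarrow>
     group G \<and>
     (\<exists>\<mu> :: 'a set \<Rightarrow> real.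
        (\<forall>A. A \<subseteq> carrier G \<longrightarrow> 0 \<le> \<mu> A) \<and>
        \<mu> (carrier G) = 1 \<and>
        (\<forall>A B. A \<subseteq> carrier G \<longrightarrow> B \<subseteq> carrier G \<longrightarrow> A \<inter> B = {} \<longrightarrow> \<mu> (A \<union> B) = \<mu> A + \<mu> B) \<and>
        (\<forall>g\<in>carrier G. \<forall>A. A \<subseteq> carrier G \<longrightarrow> \<mu> (g <#\<^bsub>G\<^esub> A) = \<mu> A))"

definition has_exponent :: "('a, 'b) monoid_scheme \<Rightarrow> nat \<Rightarrow> bool" where
  "has_exponent G n \<longleftrightarrow>
     n > 0 \<and> (\<forall>x\<in>carrier G. x [^]\<^bsub>G\<^esub> n = \<one>\<^bsub>G\<^esub>) \<and>
     (\<forall>m::nat. m > 0 \<longrightarrow> (\<forall>x\<in>carrier G. x [^]\<^bsub>G\<^esub> m = \<one>\<^bsub>G\<^esub>) \<longrightarrow> n \<le> m)"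

text \<open>The sequence \<open>ps\<close> is indexed from 1; the value \<open>ps 0\<close> is never used. Every term of the
  series is normal in the whole group \<open>G\<close>.\<close>

definition Pi_series :: "(nat \<Rightarrow> nat) \<Rightarrow> ('a, 'b) monoid_scheme \<Rightarrow> (nat \<Rightarrow> 'a set) \<Rightarrow> bool" where
  "Pi_series ps G N \<longleftrightarrow>
     N 0 = carrier G \<and> (\<forall>i. N i \<lhd> G) \<and>
     (\<forall>i\<ge>1. N i \<subseteq> N (i - 1) \<and>
        (let Q = (G\<lparr>carrier := N (i - 1)\<rparr>) Mod (N i)
         in carrier Q = {\<one>\<^bsub>Q\<^esub>} \<or> (comm_group Q \<and> has_exponent Q (ps i))))"

definition Pi_graded :: "(nat \<Rightarrow> nat) \<Rightarrow> ('a, 'b) monoid_scheme \<Rightarrow> bool" where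
  "Pi_graded ps G \<longleftrightarrow>
     group G \<and> (\<exists>N. Pi_series ps G N \<and> (\<Inter>i. N i) = {\<one>\<^bsub>G\<^esub>})"

end

theory Submission
  imports Defs
begin

text \<open>
  Let \<open>\<Gamma>\<close> be freely generated by three letters. Build a descending tower of normal subgroups of finite
  index: given \<open>Q = \<Gamma> / N\<^sub>i\<close> and \<open>p = p\<^sub>i\<^sub>+\<^sub>1\<close>, label the edges of the Cayley graph of \<open>Q\<close> by elements of
  \<open>\<int> / p\<close> and let \<open>N\<^sub>i\<^sub>+\<^sub>1\<close> consist of those \<open>w \<in> N\<^sub>i\<close> whose path sum vanishes for all admissible
  labellings. A labelling is admissible if, for each word \<open>s\<close> whose order \<open>m\<close> in \<open>Q\<close> has already
  reached a threshold \<open>2\<^sup>k\<close> attached to \<open>s\<close>, it sums to zero along the loops \<open>s\<^sup>m\<close>. So the order of \<open>s\<close> either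
  stays below the threshold or freezes once it has reached it, and the limit group \<open>G\<close> is torsion.

  There are only \<open>|Q| / m\<close> loops \<open>s\<^sup>m\<close>, hence with thresholds \<open>2, 4, 8, \<dots>\<close> at most \<open>|Q|\<close> linear
  conditions on \<open>3 |Q|\<close> labels: there is a set \<open>B\<close> of \<open>2 |Q|\<close> edges whose labels can be prescribed
  freely. Given a finite \<open>F \<subseteq> G\<close> that embeds into \<open>Q\<close>, some translate \<open>F q\<close> emits at least
  \<open>2 |F|\<close> edges of \<open>B\<close>. On these edges a labelling is the difference of a potential on
  \<open>F \<union> X F\<close>, where \<open>X\<close> is the set of letters, so \<open>p ^ (2 |F|)\<close> labellings come from at most
  \<open>p ^ |F \<union> X F|\<close> potentials and \<open>|F \<union> X F| \<ge> 2 |F|\<close>. By Hall's theorem \<open>G\<close> is paradoxical.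
\<close>

section \<open>Hall's theorem and paradoxical groups\<close>

text \<open>Rado's proof: a minimal relation that satisfies the marriage condition is single-valued.\<close>

lemma hall_marriage:
  fixes A :: "'a \<Rightarrow> 'b set"
  assumes fin: "\<And>i. i \<in> I \<Longrightarrow> finite (A i)"
    and hall: "\<And>J. finite J \<Longrightarrow> J \<subseteq> I \<Longrightarrow> card J \<le> card (\<Union>(A ` J))"
  obtains f where "inj_on f I" "\<And>i. i \<in> I \<Longrightarrow> f i \<in> A i"
proof -
  define hallian where
    "hallian R \<longleftrightarrow> (\<forall>J. finite J \<longrightarrow> J \<subseteq> I \<longrightarrow> card J \<le> card (R `` J))" for R :: "('a \<times> 'b) set"
  define S where "S = Sigma I A"
  \<comment> \<open>\<open>\<D>\<close> collects the sets of pairs that can be deleted from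
    \<open>S\<close> without losing the marriage condition; a maximal one leaves a minimal
    relation.\<close>
  define \<D> where "\<D> = {D. D \<subseteq> S \<and> hallian (S - D)}"
  have fin_S: "finite (S `` J)" if "finite J" for J
  proof -
    have "S `` J \<subseteq> \<Union>(A ` (J \<inter> I))" by (auto simp: S_def)
    then show ?thesis using that fin by (meson IntE finite_Int finite_UN_I finite_subset)
  qed
  have S_Image: "S `` J = \<Union>(A ` J)" if "J \<subseteq> I" for J using that by (auto simp: S_def)
  have "{} \<in> \<D>" using hall S_Image by (auto simp: \<D>_def hallian_def)
  moreover have "\<Union>\<C> \<in> \<D>" if ne: "\<C> \<noteq> {}" and ch: "subset.chain \<D> \<C>" for \<C>
  proof -
    have sub: "\<C> \<subseteq> \<D>" using ch by (simp add: subset.chain_def)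
    have "card J \<le> card ((S - \<Union>\<C>) `` J)" if J: "finite J" "J \<subseteq> I" for J
    proof -
      \<comment> \<open>Only finitely many pairs of \<open>S\<close> lie over \<open>J\<close>, so a
        single member of the chain already contains all those that the union deletes.\<close>
      have "finite (S \<inter> (J \<times> UNIV) \<inter> \<Union>\<C>)"
      proof (rule finite_subset)
        show "S \<inter> (J \<times> UNIV) \<inter> \<Union>\<C> \<subseteq> J \<times> S `` J" by auto
      qed (use J fin_S in auto)
      then obtain D where D: "D \<in> \<C>" "(S \<inter> (J \<times> UNIV) \<inter> \<Union>\<C>) \<subseteq> D"
        using finite_subset_Union_chain[OF _ _ ne, of "S \<inter> (J \<times> UNIV) \<inter> \<Union>\<C>" \<D>] ch
        by (metis Int_lower2)
      then have "(S - \<Union>\<C>) `` J = (S - D) `` J" by blast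
      then show ?thesis using D sub J by (auto simp: \<D>_def hallian_def)
    qed
    then show ?thesis using sub by (auto simp: \<D>_def hallian_def)
  qed
  ultimately obtain D where D: "D \<in> \<D>" and max: "\<And>Z. Z \<in> \<D> \<Longrightarrow> D \<subseteq> Z \<Longrightarrow> Z = D"
    using subset_Zorn_nonempty[of \<D>] by blast
  define R where "R = S - D"
  have R: "card J \<le> card (R `` J)" if "finite J" "J \<subseteq> I" for J
    using D that by (simp add: R_def \<D>_def hallian_def)
  have fin_R: "finite (R `` J)" if "finite J" for J
    by (rule finite_subset[OF _ fin_S[OF that]]) (auto simp: R_def)
  have delete: "\<exists>J. finite J \<and> J \<subseteq> I \<and> i \<notin> J \<and> card (R `` J \<union> (R `` {i} - {x})) \<le> card J"
    if i: "i \<in> I" and x: "(i, x) \<in> R" for i x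
  proof -
    \<comment> \<open>By maximality, deleting \<open>(i, x)\<close> as well breaks the condition at
      some \<open>J\<close>, and \<open>J\<close> contains \<open>i\<close> because other sets do
      not see this pair.\<close>
    have "insert (i, x) D \<notin> \<D>" using max[of "insert (i, x) D"] x by (auto simp: R_def)
    then have "\<not> hallian (R - {(i, x)})"
      using x D by (auto simp: \<D>_def R_def Diff_insert[symmetric])
    then obtain J where J: "finite J" "J \<subseteq> I" "card ((R - {(i, x)}) `` J) < card J"
      by (auto simp: hallian_def not_le)
    have "i \<in> J"
    proof (rule ccontr)
      assume "i \<notin> J"
      then have "(R - {(i, x)}) `` J = R `` J" by auto
      then show False using R[OF J(1,2)] J(3) by simp
    qed
    have "R `` (J - {i}) \<union> (R `` {i} - {x}) = (R - {(i, x)}) `` J" using \<open>i \<in> J\<close> by blast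
    then have "card (R `` (J - {i}) \<union> (R `` {i} - {x})) \<le> card (J - {i})"
      using J \<open>i \<in> J\<close> by simp
    then show ?thesis using J by blast
  qed
  have single: "x = y" if i: "i \<in> I" and x: "(i, x) \<in> R" and y: "(i, y) \<in> R" for i x y
  proof (rule ccontr)
    assume "x \<noteq> y"
    obtain J where J: "finite J" "J \<subseteq> I" "i \<notin> J" "card (R `` J \<union> (R `` {i} - {x})) \<le> card J"
      using delete[OF i x] by blast
    obtain K where K: "finite K" "K \<subseteq> I" "i \<notin> K" "card (R `` K \<union> (R `` {i} - {y})) \<le> card K"
      using delete[OF i y] by blast
    let ?A = "R `` J \<union> (R `` {i} - {x})" and ?B = "R `` K \<union> (R `` {i} - {y})"
    have fin': "finite ?A" "finite ?B" using J K fin_R by auto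
    \<comment> \<open>As \<open>x \<noteq> y\<close>, the union contains all neighbours of
      \<open>i\<close>, so it has at least \<open>card (J \<union> K) + 1\<close> elements. Counting
      union and intersection then contradicts the bounds on \<open>?A\<close> and
      \<open>?B\<close>.\<close>
    have "?A \<union> ?B = R `` insert i (J \<union> K)" using \<open>x \<noteq> y\<close> by auto
    then have 1: "card (J \<union> K) + 1 \<le> card (?A \<union> ?B)"
      using R[of "insert i (J \<union> K)"] J K i by simp
    have 2: "card (J \<inter> K) \<le> card (?A \<inter> ?B)"
    proof -
      have "card (J \<inter> K) \<le> card (R `` (J \<inter> K))" using R[of "J \<inter> K"] J by blast
      also have "\<dots> \<le> card (?A \<inter> ?B)" by (rule card_mono) (use fin' in auto)
      finally show ?thesis .
    qed
    have "card ?A + card ?B = card (?A \<union> ?B) + card (?A \<inter> ?B)" by (rule card_Un_Int[OF fin'])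
    moreover have "card J + card K = card (J \<union> K) + card (J \<inter> K)" by (rule card_Un_Int) (use J K in auto)
    ultimately show False using 1 2 J(4) K(4) by linarith
  qed
  have "\<exists>x. (i, x) \<in> R" if "i \<in> I" for i
  proof -
    have "R `` {i} \<noteq> {}" using R[of "{i}"] that by force
    then show ?thesis by blast
  qed
  then obtain f where "\<forall>i\<in>I. (i, f i) \<in> R" using bchoice[of I "\<lambda>i x. (i, x) \<in> R"] by blast
  then have f: "\<And>i. i \<in> I \<Longrightarrow> (i, f i) \<in> R" by blast
  have "inj_on f I"
  proof (rule inj_onI, rule ccontr)
    fix i j assume ij: "i \<in> I" "j \<in> I" "f i = f j" "i \<noteq> j"
    have "(i, f i) \<in> R" "(j, f i) \<in> R" using f ij by metis+
    then have "R `` {i, j} = {f i}" using single ij by blast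
    then show False using R[of "{i, j}"] ij by simp
  qed
  moreover have "f i \<in> A i" if "i \<in> I" for i using f[OF that] by (auto simp: R_def S_def)
  ultimately show ?thesis using that by blast
qed

text \<open>Hall's theorem, applied to two copies of \<open>carrier G\<close>, yields an injection
  \<open>\<psi>\<close> that moves each element by left multiplication with some \<open>y\<close> in
  \<open>Y\<close>. Both copies are cut into finitely many pieces according to \<open>y\<close>; the
  translated pieces are disjoint in \<open>G\<close>, yet an invariant mean would give them total
  measure 2.\<close>

lemma expanding_not_amenable:
  fixes G (structure)
  assumes "group G" and Y: "finite Y" "Y \<subseteq> carrier G"
    and expand: "\<And>F. finite F \<Longrightarrow> F \<subseteq> carrier G \<Longrightarrow> 2 * card F \<le> card (Y <#> F)"
  shows "\<not> amenable_group G"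
proof
  interpret group G by fact
  assume "amenable_group G"
  then obtain \<mu> :: "'a set \<Rightarrow> real" where
    nonneg: "\<forall>A. A \<subseteq> carrier G \<longrightarrow> 0 \<le> \<mu> A" and one: "\<mu> (carrier G) = 1"
    and add_all: "\<forall>A B. A \<subseteq> carrier G \<longrightarrow> B \<subseteq> carrier G \<longrightarrow> A \<inter> B = {} \<longrightarrow> \<mu> (A \<union> B) = \<mu> A + \<mu> B"
    and inv: "\<forall>g\<in>carrier G. \<forall>A. A \<subseteq> carrier G \<longrightarrow> \<mu> (g <# A) = \<mu> A"
    unfolding amenable_group_def by (elim exE conjE)
  have add: "\<mu> (A \<union> B) = \<mu> A + \<mu> B"
    if "A \<subseteq> carrier G" "B \<subseteq> carrier G" "A \<inter> B = {}" for A B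
    using add_all that by simp
  have empty: "\<mu> {} = 0" using add[of "{}" "{}"] by simp
  have mono: "\<mu> A \<le> 1" if "A \<subseteq> carrier G" for A
  proof -
    have "\<mu> (A \<union> (carrier G - A)) = \<mu> A + \<mu> (carrier G - A)" by (rule add) (use that in auto)
    moreover have "A \<union> (carrier G - A) = carrier G" using that by blast
    ultimately have "\<mu> A + \<mu> (carrier G - A) = 1" using one by simp
    moreover have "0 \<le> \<mu> (carrier G - A)" by (simp add: nonneg)
    ultimately show ?thesis by linarith
  qed
  have sum: "\<mu> (\<Union>i\<in>K. A i) = (\<Sum>i\<in>K. \<mu> (A i))"
    if "finite K" "\<And>i. i \<in> K \<Longrightarrow> A i \<subseteq> carrier G"
      "\<And>i j. i \<in> K \<Longrightarrow> j \<in> K \<Longrightarrow> i \<noteq> j \<Longrightarrow> A i \<inter> A j = {}" for K and A :: "'k \<Rightarrow> 'a set"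
    using that
  proof (induction K)
    case empty
    then show ?case using \<open>\<mu> {} = 0\<close> by simp
  next
    case (insert k K)
    have "\<mu> (A k \<union> (\<Union>i\<in>K. A i)) = \<mu> (A k) + \<mu> (\<Union>i\<in>K. A i)"
    proof (rule add)
      show "A k \<inter> (\<Union>i\<in>K. A i) = {}"
      proof -
        have "A k \<inter> A i = {}" if "i \<in> K" for i
          using insert.prems(2)[of k i] insert.hyps that by auto
        then show ?thesis by blast
      qed
    qed (use insert.prems(1) in auto)
    moreover have "\<mu> (\<Union>i\<in>K. A i) = (\<Sum>i\<in>K. \<mu> (A i))" using insert by (intro insert.IH) auto
    ultimately show ?case using insert.hyps by simp
  qed
  have "\<exists>\<psi>. inj_on \<psi> (carrier G \<times> (UNIV :: bool set)) \<and>
      (\<forall>i\<in>carrier G \<times> (UNIV :: bool set). \<psi> i \<in> (\<lambda>y. y \<otimes> fst i) ` Y)"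
  proof (rule hall_marriage[of "carrier G \<times> (UNIV :: bool set)" "\<lambda>i. (\<lambda>y. y \<otimes> fst i) ` Y"])
    fix J :: "('a \<times> bool) set" assume J: "finite J" "J \<subseteq> carrier G \<times> UNIV"
    have "card J \<le> card (fst ` J \<times> (UNIV :: bool set))"
      by (rule card_mono) (use J in \<open>force+\<close>)
    also have "\<dots> = 2 * card (fst ` J)" by (simp add: card_cartesian_product)
    also have "\<dots> \<le> card (Y <#> fst ` J)" by (rule expand) (use J in auto)
    also have "Y <#> fst ` J = (\<Union>i\<in>J. (\<lambda>y. y \<otimes> fst i) ` Y)" by (auto simp: set_mult_def)
    finally show "card J \<le> card (\<Union>i\<in>J. (\<lambda>y. y \<otimes> fst i) ` Y)" .
  qed (use Y in auto)
  then obtain \<psi> where inj: "inj_on \<psi> (carrier G \<times> (UNIV :: bool set))"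
    and \<psi>_mem: "\<forall>i\<in>carrier G \<times> (UNIV :: bool set). \<psi> i \<in> (\<lambda>y. y \<otimes> fst i) ` Y"
    by (elim exE conjE)
  have \<psi>: "\<exists>y\<in>Y. \<psi> (g, b) = y \<otimes> g" if "g \<in> carrier G" for g b
    using bspec[OF \<psi>_mem, of "(g, b)"] that by (auto simp: image_iff)
  define P where "P b y = {g \<in> carrier G. \<psi> (g, b) = y \<otimes> g}" for b y
  have P_sub: "P b y \<subseteq> carrier G" for b y by (auto simp: P_def)
  have yP: "y <# P b y = (\<lambda>g. \<psi> (g, b)) ` P b y" for b y
    by (auto simp: l_coset_def P_def image_iff)
  have "(\<Sum>y\<in>Y. \<mu> (P b y)) = 1" for b
  proof -
    have "\<mu> (\<Union>y\<in>Y. P b y) = (\<Sum>y\<in>Y. \<mu> (P b y))"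
    proof (rule sum)
      show "P b y \<inter> P b z = {}" if "y \<in> Y" "z \<in> Y" "y \<noteq> z" for y z
        using that Y by (auto simp: P_def subset_iff)
    qed (use Y P_sub in auto)
    moreover have "(\<Union>y\<in>Y. P b y) = carrier G" using \<psi> by (auto simp: P_def)
    ultimately show ?thesis using one by simp
  qed
  then have "2 = (\<Sum>b\<in>(UNIV :: bool set). \<Sum>y\<in>Y. \<mu> (P b y))" by simp
  also have "\<dots> = (\<Sum>b\<in>(UNIV :: bool set). \<Sum>y\<in>Y. \<mu> (y <# P b y))"
    by (intro sum.cong refl) (use inv P_sub Y in auto)
  also have "\<dots> = (\<Sum>i\<in>(UNIV :: bool set) \<times> Y. \<mu> (snd i <# P (fst i) (snd i)))"
    by (simp add: sum.cartesian_product split_def)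
  also have "\<dots> = \<mu> (\<Union>i\<in>UNIV \<times> Y. snd i <# P (fst i) (snd i))"
  proof (rule sum[symmetric])
    fix i j :: "bool \<times> 'a" assume ij: "i \<in> UNIV \<times> Y" "j \<in> UNIV \<times> Y" "i \<noteq> j"
    show "(snd i <# P (fst i) (snd i)) \<inter> (snd j <# P (fst j) (snd j)) = {}"
    proof (rule ccontr)
      assume "(snd i <# P (fst i) (snd i)) \<inter> (snd j <# P (fst j) (snd j)) \<noteq> {}"
      then obtain g h where g: "g \<in> P (fst i) (snd i)" and h: "h \<in> P (fst j) (snd j)"
        and eq: "\<psi> (g, fst i) = \<psi> (h, fst j)" unfolding yP by auto
      have "(g, fst i) = (h, fst j)" by (rule inj_onD[OF inj eq]) (use g h P_sub in auto)
      then have "snd i \<otimes> g = snd j \<otimes> g" "g \<in> carrier G" "fst i = fst j"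
        using g h by (auto simp: P_def)
      then show False using ij Y by (auto simp: prod_eq_iff subset_iff)
    qed
  qed (use Y P_sub in \<open>auto simp: l_coset_def subset_iff\<close>)
  also have "\<dots> \<le> 1"
    by (rule mono) (use Y P_sub in \<open>auto simp: l_coset_def subset_iff\<close>)
  finally show False by simp
qed

section \<open>Linear equations modulo a prime\<close>

text \<open>Functionals stay integer-valued; an equation modulo \<open>p\<close> is then a
  divisibility statement, and no field of residues has to be introduced.\<close>

definition int_linear :: "(('e \<Rightarrow> int) \<Rightarrow> int) \<Rightarrow> bool" where
  "int_linear L \<longleftrightarrow> (\<forall>f g k. L (\<lambda>e. f e + k * g e) = L f + k * L g)"

lemma int_linearD: "int_linear L \<Longrightarrow> L (\<lambda>e. f e + k * g e) = L f + k * L g"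
  by (simp add: int_linear_def)

lemma int_linear_expand:
  assumes L: "int_linear L" and "finite E" and "\<And>e. e \<notin> E \<Longrightarrow> f e = 0"
  shows "L f = (\<Sum>e\<in>E. f e * L (\<lambda>e'. of_bool (e' = e)))"
  using assms(2,3)
proof (induction E arbitrary: f)
  case empty
  \<comment> \<open>Here \<open>f\<close> is zero, hence equal to its own double, and linearity
    forces \<open>L f = 0\<close>.\<close>
  then have "f = (\<lambda>e. f e + 1 * f e)" by fastforce
  then have "L f = L f + 1 * L f" using L by (metis int_linear_def)
  then show ?case by simp
next
  case (insert a E)
  let ?g = "f(a := 0)"
  have "L f = L (\<lambda>e. ?g e + f a * of_bool (e = a))"
    by (rule arg_cong[of _ _ L]) auto
  also have "\<dots> = L ?g + f a * L (\<lambda>e. of_bool (e = a))"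
    by (rule int_linearD[OF L])
  also have "L ?g = (\<Sum>e\<in>E. ?g e * L (\<lambda>e'. of_bool (e' = e)))" using insert by (intro insert.IH) auto
  also have "\<dots> = (\<Sum>e\<in>E. f e * L (\<lambda>e'. of_bool (e' = e)))"
    by (rule sum.cong) (use insert in auto)
  finally show ?case using insert by simp
qed

text \<open>Gaussian elimination modulo \<open>p\<close>: \<open>E - B\<close> is the set of pivots.\<close>

lemma free_coordinates:
  fixes L :: "'i \<Rightarrow> ('e \<Rightarrow> int) \<Rightarrow> int" and p :: int
  assumes "Factorial_Ring.prime p" "finite I" "finite E" "\<And>i. i \<in> I \<Longrightarrow> int_linear (L i)"
  shows "\<exists>B\<subseteq>E. card (E - B) \<le> card I \<and>
    (\<forall>f. \<exists>c. (\<forall>e\<in>B. c e = f e) \<and> (\<forall>e. e \<notin> E \<longrightarrow> c e = 0) \<and> (\<forall>i\<in>I. p dvd L i c))"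
  using assms(2-)
proof (induction I arbitrary: L E)
  case empty
  have "\<exists>c. (\<forall>e\<in>E. c e = f e) \<and> (\<forall>e. e \<notin> E \<longrightarrow> c e = 0)" for f :: "'e \<Rightarrow> int"
    by (rule exI[of _ "\<lambda>e. if e \<in> E then f e else 0"]) auto
  then show ?case by (intro exI[of _ E]) auto
next
  case (insert i I)
  let ?\<delta> = "\<lambda>e e'. of_bool (e' = e) :: int"
  have lin: "int_linear (L j)" if "j \<in> insert i I" for j using insert.prems(2) that by blast
  show ?case
  proof (cases "\<forall>e\<in>E. p dvd L i (?\<delta> e)")
    case True
    \<comment> \<open>Vectors supported in \<open>E\<close> satisfy equation \<open>i\<close>
      automatically in this case, so no pivot is spent on it.\<close>
    obtain B where B: "B \<subseteq> E" "card (E - B) \<le> card I"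
      and ext: "\<And>f. \<exists>c. (\<forall>e\<in>B. c e = f e) \<and> (\<forall>e. e \<notin> E \<longrightarrow> c e = 0) \<and> (\<forall>j\<in>I. p dvd L j c)"
      using insert.IH[OF \<open>finite E\<close>, of L] lin by blast
    have "p dvd L i c" if "\<forall>e. e \<notin> E \<longrightarrow> c e = 0" for c
      using int_linear_expand[OF lin[of i] \<open>finite E\<close>, of c] that True by (auto intro!: dvd_sum)
    then have "\<exists>c. (\<forall>e\<in>B. c e = f e) \<and> (\<forall>e. e \<notin> E \<longrightarrow> c e = 0) \<and> (\<forall>j\<in>insert i I. p dvd L j c)" for f
      using ext[of f] by blast
    moreover have "card (E - B) \<le> card (insert i I)" using B insert.hyps by simp
    ultimately show ?thesis using B(1) by blast
  next
    case False
    then obtain a where a: "a \<in> E" "\<not> p dvd L i (?\<delta> a)" by blast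
    then have "coprime (L i (?\<delta> a)) p" using \<open>Factorial_Ring.prime p\<close> by (simp add: coprime_commute prime_imp_coprime)
    then obtain r s where "r * L i (?\<delta> a) + s * p = 1"
      using bezout_int[of "L i (?\<delta> a)" p] by (auto simp: coprime_iff_gcd_eq_1)
    then have r: "L i (?\<delta> a) * r = 1 - s * p" by (simp add: algebra_simps)
    \<comment> \<open>\<open>r\<close> inverts the coefficient of \<open>a\<close> modulo
      \<open>p\<close>, and \<open>M j\<close> is equation \<open>j\<close> with the coordinate
      \<open>a\<close> eliminated by means of equation \<open>i\<close>.\<close>
    define M where "M j c = L j c - L j (?\<delta> a) * r * L i c" for j c
    have "int_linear (M j)" if "j \<in> I" for j
      using lin[of j] lin[of i] that by (auto simp: int_linear_def M_def algebra_simps)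
    then obtain B where B: "B \<subseteq> E - {a}" "card (E - {a} - B) \<le> card I"
      and ext: "\<And>f. \<exists>c. (\<forall>e\<in>B. c e = f e) \<and> (\<forall>e. e \<notin> E - {a} \<longrightarrow> c e = 0) \<and> (\<forall>j\<in>I. p dvd M j c)"
      using insert.IH[of "E - {a}" M] \<open>finite E\<close> by blast
    have "\<exists>c. (\<forall>e\<in>B. c e = f e) \<and> (\<forall>e. e \<notin> E \<longrightarrow> c e = 0) \<and> (\<forall>j\<in>insert i I. p dvd L j c)" for f
    proof -
      obtain c where c: "\<forall>e\<in>B. c e = f e" "\<forall>e. e \<notin> E - {a} \<longrightarrow> c e = 0" "\<forall>j\<in>I. p dvd M j c"
        using ext[of f] by blast
      \<comment> \<open>The pivot coordinate \<open>a\<close> receives the value that makes equation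
        \<open>i\<close> hold modulo \<open>p\<close>; then \<open>L j d\<close> equals
        \<open>M j c\<close> for the other equations.\<close>
      define t where "t = - r * L i c"
      define d where "d = (\<lambda>e. c e + t * ?\<delta> a e)"
      have Ld: "L j d = L j c + t * L j (?\<delta> a)" if "j \<in> insert i I" for j
        unfolding d_def by (rule int_linearD[OF lin[OF that]])
      have "L j d = M j c" if "j \<in> I" for j using Ld[of j] that by (simp add: t_def M_def)
      moreover have "L i d = L i c - L i c * (L i (?\<delta> a) * r)" using Ld[of i] by (simp add: t_def)
      then have "L i d = p * (s * L i c)" unfolding r by (simp add: algebra_simps)
      ultimately have "\<forall>j\<in>insert i I. p dvd L j d" using c(3) by auto
      moreover have "\<forall>e\<in>B. d e = f e" using c(1) B by (auto simp: d_def)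
      moreover have "\<forall>e. e \<notin> E \<longrightarrow> d e = 0" using c(2) a by (auto simp: d_def)
      ultimately show ?thesis by blast
    qed
    moreover have "card (E - B) \<le> card (insert i I)"
    proof -
      have "E - B = insert a (E - {a} - B)" using a B by auto
      then have "card (E - B) \<le> Suc (card (E - {a} - B))" 
        using \<open>finite E\<close> by (simp add: card_insert_if)
      then show ?thesis using B insert.hyps by simp
    qed
    ultimately show ?thesis using B(1) by blast
  qed
qed

section \<open>Congruences of words and their refinement\<close>

text \<open>With three letters each vertex emits three edges. The conditions use up at most one edge
  per vertex on average, and the two that remain are the factor 2 in the expansion.\<close>

type_synonym letter = "bool option"
type_synonym word = "letter list"

lemma card_letter: "card (UNIV :: letter set) = 3"
  by (simp add: UNIV_option_conv card_image UNIV_bool)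

definition wpow :: "nat \<Rightarrow> word \<Rightarrow> word" where
  "wpow n w = concat (replicate n w)"

lemma wpow_0 [simp]: "wpow 0 w = []"
  by (simp add: wpow_def)

lemma wpow_Suc: "wpow (Suc n) w = w @ wpow n w"
  by (simp add: wpow_def)

lemma wpow_add: "wpow (m + n) w = wpow m w @ wpow n w"
  by (simp add: wpow_def replicate_add)

lemma wpow_1 [simp]: "wpow (Suc 0) w = w"
  by (simp add: wpow_Suc)

lemma wpow_mult: "wpow (m * n) w = wpow m (wpow n w)"
  by (induction m) (simp_all add: wpow_add wpow_Suc)

lemma wpow_commute: "wpow m w @ wpow n w = wpow n w @ wpow m w"
  by (metis add.commute wpow_add)

locale word_congruence =
  fixes R :: "word \<Rightarrow> word \<Rightarrow> bool"
  assumes equiv: "equivp R"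
    and append: "R u u' \<Longrightarrow> R v v' \<Longrightarrow> R (u @ v) (u' @ v')"

context word_congruence
begin

lemma R_iff: "R u v \<longleftrightarrow> R u = R v"
  using equiv by (simp add: equivp_def)

lemma refl [simp]: "R u u"
  by (simp add: R_iff)

lemma sym: "R u v \<Longrightarrow> R v u"
  by (simp add: R_iff)

lemma trans [trans]: "R u v \<Longrightarrow> R v w \<Longrightarrow> R u w"
  by (simp add: R_iff)

lemma wpow_trivial: "R w [] \<Longrightarrow> R (wpow n w) []"
  by (induction n) (use append[of w "[]"] in \<open>auto simp: wpow_Suc\<close>)

end

section \<open>Orders, inverses and cycles in a torsion quotient\<close>

definition word_ord :: "(word \<Rightarrow> word \<Rightarrow> bool) \<Rightarrow> word \<Rightarrow> nat" where
  "word_ord R s = (LEAST n. n > 0 \<and> R (wpow n s) [])"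

text \<open>Positive words suffice to present a torsion group, because inverses are positive powers.\<close>

locale torsion_congruence = word_congruence +
  assumes torsion: "\<exists>n>0. R (wpow n s) []"
begin

lemma word_ord: "word_ord R s > 0" "R (wpow (word_ord R s) s) []"
  unfolding word_ord_def using LeastI_ex[OF torsion[of s]] by blast+

lemma word_ord_least: "n > 0 \<Longrightarrow> R (wpow n s) [] \<Longrightarrow> word_ord R s \<le> n"
  unfolding word_ord_def by (rule Least_le) blast

definition winv :: "word \<Rightarrow> word" where
  "winv s = wpow (word_ord R s - 1) s"

lemma winv_left: "R (winv s @ s) []"
  using word_ord[of s] wpow_add[of "word_ord R s - 1" 1 s] by (simp add: winv_def)

lemma winv_right: "R (s @ winv s) []"
  using word_ord[of s] wpow_Suc[of "word_ord R s - 1" s] by (simp add: winv_def)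

lemma cancel_right:
  assumes "R (u @ w) (v @ w)"
  shows "R u v"
proof -
  have "R (u @ w @ winv w) (u @ [])" "R (v @ w @ winv w) (v @ [])"
    by (intro append refl winv_right)+
  moreover have "R (u @ w @ winv w) (v @ w @ winv w)"
    using append[OF assms refl[of "winv w"]] by simp
  ultimately show ?thesis by (simp add: R_iff)
qed

text \<open>Cancelling \<open>wpow j s @ u\<close> would make a positive power of \<open>s\<close>
  below its order trivial. Thus left multiplication by \<open>s\<close> has no cycle shorter than
  the order.\<close>

lemma wpow_inj:
  assumes "R (wpow j s @ u) (wpow k s @ u)" "j \<le> k" "k < word_ord R s"
  shows "j = k"
proof (rule ccontr)
  assume "j \<noteq> k"
  have "wpow k s @ u = wpow (k - j) s @ (wpow j s @ u)"
    using assms(2) wpow_add[of "k - j" j s] by simp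
  then have "R ([] @ (wpow j s @ u)) (wpow (k - j) s @ (wpow j s @ u))"
    using assms(1) by (simp only: append_Nil)
  then have "R [] (wpow (k - j) s)" by (rule cancel_right)
  then have "word_ord R s \<le> k - j" using \<open>j \<noteq> k\<close> assms(2) by (intro word_ord_least sym[of "[]"]) auto
  then show False using assms(3) \<open>j \<noteq> k\<close> assms(2) by linarith
qed

text \<open>A cycle of left multiplication by \<open>s\<close> on the classes. The full loop along
  it has the same path sum from each of its vertices, so a cycle costs only one linear
  condition.\<close>

definition orbit :: "word \<Rightarrow> word \<Rightarrow> (word \<Rightarrow> bool) set" where
  "orbit s u = range (\<lambda>k. R (wpow k s @ u))"

lemma orbit_subset:
  assumes "R (wpow k s @ u) (wpow l s @ v)"
  shows "orbit s u \<subseteq> orbit s v"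
proof -
  \<comment> \<open>\<open>m + k\<close> is a multiple of the order, so \<open>wpow m s\<close>
    inverts \<open>wpow k s\<close> and puts \<open>u\<close> on the cycle through
    \<open>v\<close>.\<close>
  define m where "m = word_ord R s * k - k"
  have m: "m + k = k * word_ord R s" using word_ord(1)[of s] by (simp add: m_def)
  have "R (wpow (m + k) s) []" unfolding m wpow_mult by (rule wpow_trivial[OF word_ord(2)])
  then have "R (wpow (m + k) s @ u) ([] @ u)" by (rule append) simp
  then have "R u (wpow m s @ wpow k s @ u)" by (auto simp: wpow_add intro: sym)
  also have "R (wpow m s @ wpow k s @ u) (wpow m s @ wpow l s @ v)" by (intro append assms refl)
  finally have u: "R u (wpow (m + l) s @ v)" by (simp add: wpow_add)
  have "R (wpow j s @ u) = R (wpow (j + (m + l)) s @ v)" for j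
    using append[OF refl[of "wpow j s"] u] by (simp add: wpow_add R_iff)
  then show ?thesis by (auto simp: orbit_def)
qed

lemma orbit_disjoint: "orbit s u = orbit s v \<or> orbit s u \<inter> orbit s v = {}"
proof (rule disjCI)
  assume "orbit s u \<inter> orbit s v \<noteq> {}"
  then obtain k l where "R (wpow k s @ u) = R (wpow l s @ v)" by (auto simp: orbit_def)
  then show "orbit s u = orbit s v" using orbit_subset by (metis R_iff subset_antisym)
qed

end

section \<open>Counting cycles in a finite quotient\<close>

locale finite_congruence = torsion_congruence +
  assumes finite_range: "finite (range R)"
begin

lemma orbit_subset_range: "orbit s u \<subseteq> range R"
  unfolding orbit_def by (rule image_subsetI) (rule rangeI)

lemma finite_orbit: "finite (orbit s u)"
  by (rule finite_subset[OF orbit_subset_range finite_range])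

lemma finite_orbits: "finite (range (orbit s))"
proof (rule finite_subset)
  show "range (orbit s) \<subseteq> Pow (range R)" using orbit_subset_range by (intro image_subsetI PowI)
qed (simp add: finite_range)

lemma card_orbit: "word_ord R s \<le> card (orbit s u)"
proof -
  have "inj_on (\<lambda>k. R (wpow k s @ u)) {..<word_ord R s}"
  proof (rule inj_onI)
    fix j k assume "j \<in> {..<word_ord R s}" "k \<in> {..<word_ord R s}"
      "R (wpow j s @ u) = R (wpow k s @ u)"
    then show "j = k" using wpow_inj[of j s u k] wpow_inj[of k s u j] by (cases "j \<le> k") (auto simp: R_iff)
  qed
  then have "word_ord R s = card ((\<lambda>k. R (wpow k s @ u)) ` {..<word_ord R s})" by (simp add: card_image)
  also have "\<dots> \<le> card (orbit s u)"
    by (rule card_mono[OF finite_orbit]) (unfold orbit_def, rule image_mono, rule subset_UNIV)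
  finally show ?thesis .
qed

text \<open>Distinct cycles are disjoint subsets of the quotient, each with at least
  \<open>word_ord R s\<close> elements.\<close>

lemma card_orbits: "card (range (orbit s)) * word_ord R s \<le> card (range R)"
proof -
  have sub: "\<Union>(range (orbit s)) \<subseteq> range R" using orbit_subset_range by (intro Union_least) auto
  have "card (range (orbit s)) * word_ord R s = (\<Sum>C\<in>range (orbit s). word_ord R s)" by simp
  also have "\<dots> \<le> sum card (range (orbit s))" by (rule sum_mono) (use card_orbit in auto)
  also have "\<dots> = card (\<Union>(range (orbit s)))"
  proof (rule card_Union_disjoint[symmetric])
    show "pairwise disjnt (range (orbit s))"
      unfolding pairwise_def disjnt_def using orbit_disjoint by (intro ballI impI) (elim rangeE, metis)
    show "finite C" if "C \<in> range (orbit s)" for C using that finite_orbit by (elim rangeE) simp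
  qed
  also have "\<dots> \<le> card (range R)" by (rule card_mono[OF finite_range sub])
  finally show ?thesis .
qed

lemma word_ord_le_card: "word_ord R s \<le> card (range R)"
proof -
  have "word_ord R s \<le> card (orbit s [])" by (rule card_orbit)
  also have "\<dots> \<le> card (range R)" by (rule card_mono[OF finite_range orbit_subset_range])
  finally show ?thesis .
qed

end

text \<open>The class of \<open>u\<close> is the predicate \<open>R u\<close>, and the edge \<open>(R u, x)\<close> runs from \<open>u\<close> to \<open>x # u\<close>: letters
  act from the left, because \<^const>\<open>amenable_group\<close> asks for left invariance. Hence words are read
  from right to left.\<close>

primrec psum :: "(word \<Rightarrow> word \<Rightarrow> bool) \<Rightarrow> ((word \<Rightarrow> bool) \<times> letter \<Rightarrow> int) \<Rightarrow> word \<Rightarrow> word \<Rightarrow> int" where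
  "psum R f [] t = 0"
| "psum R f (x # w) t = f (R (w @ t), x) + psum R f w t"

lemma psum_append: "psum R f (u @ v) t = psum R f v t + psum R f u (v @ t)"
  by (induction u) auto

lemma int_linear_psum: "int_linear (\<lambda>f. psum R f w t)"
  unfolding int_linear_def by (induction w) (auto simp: algebra_simps)

lemma psum_mod_cong:
  assumes "\<And>u x. f (R u, x) mod p = g (R u, x) mod p"
  shows "psum R f w t mod p = psum R g w t mod p"
  by (induction w) (auto intro: mod_add_cong assms)

lemma (in word_congruence) psum_cong:
  assumes "R t t'"
  shows "psum R f w t = psum R f w t'"
proof (induction w)
  case (Cons x w)
  have "R (w @ t) = R (w @ t')" using append[OF refl assms] by (simp add: R_iff)
  then show ?case using Cons by simp
qed simp

text \<open>The thresholds make the sum of \<open>1 / word_ord R s\<close> over the frozen words at most \<open>1\<close>.\<close>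

definition frozen :: "(word \<Rightarrow> word \<Rightarrow> bool) \<Rightarrow> word set" where
  "frozen R = {s. 2 ^ Suc (to_nat s) \<le> word_ord R s}"

text \<open>The admissible labellings. Residues are represented in \<open>{0..<int p}\<close> and
  the functions are extensional, so a finite quotient has only finitely many.\<close>

definition cocycles :: "(word \<Rightarrow> word \<Rightarrow> bool) \<Rightarrow> nat \<Rightarrow> ((word \<Rightarrow> bool) \<times> letter \<Rightarrow> int) set" where
  "cocycles R p = {f \<in> (range R \<times> UNIV) \<rightarrow>\<^sub>E {0..<int p}.
     \<forall>s\<in>frozen R. \<forall>t. int p dvd psum R f (wpow (word_ord R s) s) t}"

text \<open>Sums are compared from every starting point \<open>t\<close>, because appending a word
  on the right shifts the starting point.\<close>

definition refine :: "nat \<Rightarrow> (word \<Rightarrow> word \<Rightarrow> bool) \<Rightarrow> word \<Rightarrow> word \<Rightarrow> bool" where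
  "refine p R u v \<longleftrightarrow> R u v \<and>
     (\<forall>f\<in>cocycles R p. \<forall>t. psum R f u t mod int p = psum R f v t mod int p)"

lemma refine_imp: "refine p R u v \<Longrightarrow> R u v"
  by (simp add: refine_def)

lemma refineD:
  "refine p R u v \<Longrightarrow> f \<in> cocycles R p \<Longrightarrow> psum R f u t mod int p = psum R f v t mod int p"
  by (simp add: refine_def)

section \<open>The algebra of one refinement step\<close>

context word_congruence
begin

lemma psum_wpow:
  assumes "R s []"
  shows "psum R f (wpow n s) t = int n * psum R f s t"
proof (induction n)
  case (Suc n)
  have "R (wpow n s @ t) t" using append[OF wpow_trivial[OF assms] refl] by simp
  then show ?case using Suc psum_cong by (simp add: wpow_Suc psum_append algebra_simps)
qed simp

text \<open>A path for \<open>u @ v\<close> splits at the class of \<open>v @ t\<close>, which is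
  also that of \<open>v' @ t\<close>; the two halves are then compared separately.\<close>

lemma word_congruence_refine: "word_congruence (refine p R)"
proof
  show "equivp (refine p R)"
    by (rule equivpI) (auto simp: refine_def reflp_def symp_def transp_def intro: sym trans)
  fix u u' v v' assume u: "refine p R u u'" and v: "refine p R v v'"
  have "R (u @ v) (u' @ v')" using u v by (auto simp: refine_def intro: append)
  moreover have "psum R f (u @ v) t mod int p = psum R f (u' @ v') t mod int p"
    if "f \<in> cocycles R p" for f t
  proof -
    have "R (v @ t) (v' @ t)" by (intro append refl refine_imp[OF v])
    then have "psum R f (u' @ v') t = psum R f v' t + psum R f u' (v @ t)"
      using psum_cong[of "v @ t" "v' @ t"] by (simp add: psum_append)
    then show ?thesis
      using mod_add_cong[OF refineD[OF v that, of t] refineD[OF u that, of "v @ t"]]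
      by (simp add: psum_append)
  qed
  ultimately show "refine p R (u @ v) (u' @ v')" unfolding refine_def by blast
qed

text \<open>A word trivial in \<open>R\<close> is a loop at every vertex, so repeating it
  \<open>p\<close> times multiplies its path sum by \<open>p\<close>. This bounds the exponent of
  the new layer.\<close>

lemma refine_wpow:
  assumes "R s []"
  shows "refine p R (wpow p s) []"
  using wpow_trivial[OF assms] by (simp add: refine_def psum_wpow[OF assms])

text \<open>Loops return to their base point, so their sums add up in either order. This makes the
  new layer abelian.\<close>

lemma refine_commute:
  assumes "R u []" "R v []"
  shows "refine p R (u @ v) (v @ u)"
proof -
  have "R (u @ t) ([] @ t)" "R (v @ t) ([] @ t)" for t by (intro append assms refl)+
  then have "psum R f u (v @ t) = psum R f u t" "psum R f v (u @ t) = psum R f v t" for f t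
    using psum_cong[of "u @ t" t] psum_cong[of "v @ t" t] by simp_all
  then have "psum R f (u @ v) t = psum R f (v @ u) t" for f t
    by (simp add: psum_append)
  moreover have "R (u @ v) (v @ u)"
    using append[OF assms] append[OF assms(2,1)] by (simp add: R_iff)
  ultimately show ?thesis by (simp add: refine_def)
qed

end

lemma (in torsion_congruence) torsion_congruence_refine:
  assumes "p > 0"
  shows "torsion_congruence (refine p R)"
proof -
  interpret refined: word_congruence "refine p R" by (rule word_congruence_refine)
  show ?thesis
  proof
    fix s
    have "refine p R (wpow (p * word_ord R s) s) []"
      unfolding wpow_mult by (rule refine_wpow[OF word_ord(2)])
    then show "\<exists>n>0. refine p R (wpow n s) []" using word_ord(1) assms by (metis nat_0_less_mult_iff)
  qed
qed

text \<open>Cocycles vanish modulo \<open>p\<close> along the loops of a frozen word, so its trivial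
  power stays trivial. The order cannot drop, as the refinement is finer.\<close>

lemma (in torsion_congruence) word_ord_refine:
  assumes "p > 0" "s \<in> frozen R"
  shows "word_ord (refine p R) s = word_ord R s"
proof -
  interpret refined: torsion_congruence "refine p R" by (rule torsion_congruence_refine[OF assms(1)])
  have "refine p R (wpow (word_ord R s) s) []"
    using assms(2) word_ord by (auto simp: refine_def cocycles_def)
  then have "word_ord (refine p R) s \<le> word_ord R s"
    using word_ord(1) by (intro refined.word_ord_least)
  moreover have "word_ord R s \<le> word_ord (refine p R) s"
    using refined.word_ord by (intro word_ord_least) (auto dest: refine_imp)
  ultimately show ?thesis by simp
qed

section \<open>Finiteness of refinements and the number of free labels\<close>

context finite_congruence
begin

lemma finite_cocycles: "finite (cocycles R p)"
proof -
  have "finite (range R \<times> (UNIV :: letter set))" using finite_range by simp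
  then have "finite ((range R \<times> (UNIV :: letter set)) \<rightarrow>\<^sub>E {0..<int p})" by (intro finite_PiE) auto
  then show ?thesis by (rule rev_finite_subset) (auto simp: cocycles_def)
qed

text \<open>The refined class of \<open>u\<close> is determined by \<open>R u\<close> and the table
  of path sums modulo \<open>p\<close>, in which starting points matter only up to \<open>R\<close>.
  Hence \<open>key\<close> has finite range.\<close>

lemma finite_congruence_refine:
  assumes "p > 0"
  shows "finite_congruence (refine p R)"
proof -
  interpret refined: torsion_congruence "refine p R" by (rule torsion_congruence_refine[OF assms(1)])
  define key where
    "key u = (R u, {(f, R t, psum R f u t mod int p) | f t. f \<in> cocycles R p})" for u
  have "range key \<subseteq> range R \<times> Pow (cocycles R p \<times> range R \<times> {0..<int p})"
    using assms by (auto simp: key_def)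
  then have fin: "finite (range key)"
    by (rule finite_subset) (use finite_range finite_cocycles in auto)
  have key: "refine p R u = refine p R v" if "key u = key v" for u v
  proof -
    have "psum R f u t mod int p = psum R f v t mod int p" if f: "f \<in> cocycles R p" for f t
    proof -
      have "(f, R t, psum R f u t mod int p) \<in> snd (key v)"
        using f unfolding \<open>key u = key v\<close>[symmetric] by (auto simp: key_def)
      then obtain t' where "R t = R t'" "psum R f u t mod int p = psum R f v t' mod int p"
        by (auto simp: key_def)
      then show ?thesis using psum_cong[of t t'] by (simp add: R_iff)
    qed
    moreover have "R u v" using that by (simp add: key_def R_iff)
    ultimately have "refine p R u v" by (simp add: refine_def)
    then show ?thesis by (simp add: refined.R_iff)
  qed
  have "range (refine p R) = (\<lambda>k. refine p R (inv_into UNIV key k)) ` range key"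
  proof -
    have "refine p R u = refine p R (inv_into UNIV key (key u))" for u
      by (rule key) (simp add: f_inv_into_f)
    then show ?thesis by (simp add: image_image)
  qed
  then show ?thesis using fin by unfold_locales simp
qed

text \<open>Write \<open>t\<close> as \<open>wpow k s @ u\<close> and read \<open>wpow k s\<close>
  and the full loop from \<open>u\<close> in both orders. The part \<open>wpow k s\<close>
  contributes the same sum each time, since the loop closes up.\<close>

lemma psum_wpow_orbit:
  assumes "orbit s t = orbit s u"
  shows "psum R f (wpow (word_ord R s) s) t = psum R f (wpow (word_ord R s) s) u"
proof -
  let ?m = "word_ord R s"
  have "R (wpow 0 s @ t) \<in> orbit s t" unfolding orbit_def by blast
  then have "R t \<in> orbit s u" using assms by simp
  then obtain k where k: "R t (wpow k s @ u)" by (auto simp: orbit_def R_iff)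
  have "R (wpow ?m s @ u) u" using append[OF word_ord(2) refl] by simp
  then have "psum R f (wpow k s @ wpow ?m s) u = psum R f (wpow ?m s) u + psum R f (wpow k s) u"
    by (simp add: psum_append psum_cong)
  moreover have "psum R f (wpow ?m s @ wpow k s) u = psum R f (wpow k s) u + psum R f (wpow ?m s) (wpow k s @ u)"
    by (simp add: psum_append)
  ultimately show ?thesis using psum_cong[OF k] by (simp add: wpow_commute[of ?m s k])
qed

text \<open>The threshold grows with \<open>to_nat s\<close>, whereas all orders are bounded by the
  size of the quotient.\<close>

lemma finite_frozen: "finite (frozen R)"
proof -
  have "to_nat s < card (range R)" if "s \<in> frozen R" for s
  proof -
    have "to_nat s < 2 ^ Suc (to_nat s)" by (meson Suc_lessD less_exp)
    also have "\<dots> \<le> card (range R)" using that word_ord_le_card[of s] by (simp add: frozen_def)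
    finally show ?thesis .
  qed
  then have "to_nat ` frozen R \<subseteq> {..<card (range R)}" by auto
  then have "finite (to_nat ` frozen R)" by (rule finite_subset) simp
  then show ?thesis by (rule finite_imageD) (rule inj_on_to_nat)
qed

text \<open>A frozen \<open>s\<close> has at most \<open>card (range R) / 2 ^ Suc (to_nat s)\<close>
  cycles. As \<open>to_nat\<close> is injective, the series 1/2 + 1/4 + ... bounds the
  total.\<close>

lemma sum_orbits: "(\<Sum>s\<in>frozen R. card (range (orbit s))) \<le> card (range R)"
proof -
  let ?q = "real (card (range R))"
  have "real (card (range (orbit s))) \<le> ?q * (1 / 2) ^ Suc (to_nat s)" if "s \<in> frozen R" for s
  proof -
    have "card (range (orbit s)) * 2 ^ Suc (to_nat s) \<le> card (range (orbit s)) * word_ord R s"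
      using that by (simp only: frozen_def mem_Collect_eq mult_le_mono2)
    also have "\<dots> \<le> card (range R)" by (rule card_orbits)
    finally have "real (card (range (orbit s)) * 2 ^ Suc (to_nat s)) \<le> ?q" by (rule of_nat_mono)
    then show ?thesis by (simp add: field_simps)
  qed
  then have "(\<Sum>s\<in>frozen R. real (card (range (orbit s)))) \<le> (\<Sum>s\<in>frozen R. ?q * (1 / 2) ^ Suc (to_nat s))"
    by (rule sum_mono)
  also have "\<dots> = ?q * (\<Sum>n\<in>to_nat ` frozen R. (1 / 2) ^ Suc n)"
    by (simp add: sum.reindex sum_distrib_left)
  also have "\<dots> \<le> ?q * 1"
  proof (rule mult_left_mono)
    have "(\<Sum>n\<in>to_nat ` frozen R. (1 / 2) ^ Suc n) \<le> suminf (\<lambda>n. (1 / 2 :: real) ^ Suc n)"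
      by (rule sum_le_suminf) (use power_half_series finite_frozen in \<open>auto simp: sums_iff\<close>)
    then show "(\<Sum>n\<in>to_nat ` frozen R. (1 / 2) ^ Suc n) \<le> (1 :: real)"
      using power_half_series by (simp add: sums_iff)
  qed simp
  finally have "real (\<Sum>s\<in>frozen R. card (range (orbit s))) \<le> ?q" by simp
  then show ?thesis by (simp only: of_nat_le_iff)
qed

text \<open>One equation per frozen word and cycle makes at most \<open>card (range R)\<close>
  equations, for three times as many labels; elimination leaves two thirds of the edges
  free.\<close>

lemma free_edges:
  assumes p: "Factorial_Ring.prime p"
  shows "\<exists>B\<subseteq>range R \<times> UNIV. 2 * card (range R) \<le> card B \<and>
    (\<forall>h. \<exists>f\<in>cocycles R p. \<forall>e\<in>B. f e mod int p = h e mod int p)"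
proof -
  let ?E = "range R \<times> (UNIV :: letter set)"
  define I where "I = (SIGMA s:frozen R. range (orbit s))"
  \<comment> \<open>\<open>inv_into\<close> picks a starting word on the cycle \<open>C\<close>; by
    \<open>psum_wpow_orbit\<close> the sum does not depend on the choice.\<close>
  define L where "L = (\<lambda>(s, C) f. psum R f (wpow (word_ord R s) s) (inv_into UNIV (orbit s) C))"
  have fin_I: "finite I" using finite_frozen finite_orbits by (auto simp: I_def)
  have fin_E: "finite ?E" using finite_range by simp
  have prime: "Factorial_Ring.prime (int p)" using p by simp
  have lin: "int_linear (L i)" for i by (cases i) (simp add: L_def int_linear_psum)
  obtain B where B: "B \<subseteq> ?E" "card (?E - B) \<le> card I"
    and ext: "\<forall>h. \<exists>c. (\<forall>e\<in>B. c e = h e) \<and> (\<forall>e. e \<notin> ?E \<longrightarrow> c e = 0) \<and> (\<forall>i\<in>I. int p dvd L i c)"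
    using free_coordinates[where L = L, OF prime fin_I fin_E lin] by (elim exE conjE) simp
  have "card I \<le> card (range R)"
    using sum_orbits finite_frozen finite_orbits by (simp add: I_def)
  moreover have "card ?E = 3 * card (range R)" by (simp add: card_cartesian_product card_letter)
  moreover have "card (?E - B) = card ?E - card B"
    using B fin_E by (intro card_Diff_subset) (auto intro: finite_subset)
  ultimately have "2 * card (range R) \<le> card B" using B(2) by linarith
  moreover have "\<exists>f\<in>cocycles R p. \<forall>e\<in>B. f e mod int p = h e mod int p" for h
  proof -
    obtain c where c: "\<forall>e\<in>B. c e = h e" "\<forall>i\<in>I. int p dvd L i c" using ext by (elim allE[of _ h]) blast
    \<comment> \<open>Reduction modulo \<open>p\<close> and restriction to the edges turn the
      solution into a cocycle without changing its path sums modulo \<open>p\<close>.\<close>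
    define f where "f = (\<lambda>e\<in>?E. c e mod int p)"
    have psum_f: "psum R f w t mod int p = psum R c w t mod int p" for w t
      by (rule psum_mod_cong) (simp add: f_def)
    have "int p dvd psum R f (wpow (word_ord R s) s) t" if "s \<in> frozen R" for s t
    proof -
      have "int p dvd L (s, orbit s t) c" using c(2) that by (auto simp: I_def)
      moreover have "L (s, orbit s t) c = psum R c (wpow (word_ord R s) s) t"
        unfolding L_def by (simp add: psum_wpow_orbit[of s "inv_into UNIV (orbit s) (orbit s t)" t] f_inv_into_f)
      ultimately show ?thesis using psum_f by (simp add: dvd_eq_mod_eq_0)
    qed
    moreover have "f \<in> ?E \<rightarrow>\<^sub>E {0..<int p}" using prime_gt_0_nat[OF p] by (auto simp: f_def)
    ultimately have "f \<in> cocycles R p" by (simp add: cocycles_def)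
    moreover have "f e mod int p = h e mod int p" if "e \<in> B" for e
    proof -
      have "e \<in> ?E" using B that by blast
      then show ?thesis using c(1) that by (simp add: f_def)
    qed
    ultimately show ?thesis by blast
  qed
  ultimately show ?thesis using B(1) by blast
qed

end

section \<open>Expansion\<close>

text \<open>Any congruence \<open>T\<close> finer than the refinement will do, because path sums of
  cocycles modulo \<open>p\<close> descend to its classes; the limit of the tower is the intended
  case.\<close>

lemma (in finite_congruence) expansion:
  assumes p: "Factorial_Ring.prime p"
    and T: "word_congruence T" "\<And>u v. T u v \<Longrightarrow> refine p R u v"
    and F: "finite F" "inj_on R F"
  shows "2 * card F \<le> card (T ` (F \<union> (\<Union>x. (#) x ` F)))"
proof -
  interpret T: word_congruence T by fact
  define U where "U = F \<union> (\<Union>x. (#) x ` F)"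
  have fin_U: "finite U" using F by (auto simp: U_def)
  obtain B where B: "B \<subseteq> range R \<times> UNIV" "2 * card (range R) \<le> card B"
    and ext: "\<forall>h. \<exists>f\<in>cocycles R p. \<forall>e\<in>B. f e mod int p = h e mod int p"
    using free_edges[OF p] by (elim exE conjE)
  have fin_B: "finite B" using B(1) by (rule finite_subset) (simp add: finite_range)
  define rep where "rep = inv_into UNIV R"
  have rep: "R (rep C) = C" if "C \<in> range R" for C using that by (simp add: rep_def f_inv_into_f)
  define S where "S C = {e \<in> B. \<exists>f\<in>F. fst e = R (f @ rep C)}" for C
  \<comment> \<open>An edge of \<open>B\<close> at \<open>u\<close> leaves the translate of
    \<open>F\<close> by \<open>winv f @ u\<close> for each \<open>f\<close> in \<open>F\<close>, and
    these classes are distinct by injectivity of \<open>R\<close> on \<open>F\<close>.\<close>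
  have count: "card F \<le> card {C \<in> range R. \<exists>f\<in>F. fst e = R (f @ rep C)}" if "e \<in> B" for e
  proof -
    have "fst e \<in> range R" using subsetD[OF B(1) that] by (simp add: mem_Times_iff)
    then obtain u where u: "fst e = R u" by (rule rangeE)
    have "R (f @ rep (R (winv f @ u))) u" for f
    proof -
      have "R (rep (R (winv f @ u))) (winv f @ u)" by (simp add: R_iff rep)
      then have "R (f @ rep (R (winv f @ u))) (f @ winv f @ u)" by (intro append refl)
      moreover have "R ((f @ winv f) @ u) ([] @ u)" by (intro append refl winv_right)
      ultimately show ?thesis by (simp add: R_iff)
    qed
    then have eq: "fst e = R (f @ rep (R (winv f @ u)))" for f by (simp add: u R_iff)
    have "inj_on (\<lambda>f. R (winv f @ u)) F"
    proof (rule inj_onI)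
      fix f g assume "f \<in> F" "g \<in> F" and fg: "R (winv f @ u) = R (winv g @ u)"
      have "R (f @ rep (R (winv f @ u))) (g @ rep (R (winv f @ u)))"
        using eq[of f] eq[of g] by (simp add: R_iff fg)
      then have "R f g" by (rule cancel_right)
      then show "f = g" using inj_onD[OF F(2), of f g] \<open>f \<in> F\<close> \<open>g \<in> F\<close> by (simp add: R_iff)
    qed
    then have "card F = card ((\<lambda>f. R (winv f @ u)) ` F)" by (simp add: card_image)
    also have "\<dots> \<le> card {C \<in> range R. \<exists>f\<in>F. fst e = R (f @ rep C)}"
    proof (rule card_mono)
      show "(\<lambda>f. R (winv f @ u)) ` F \<subseteq> {C \<in> range R. \<exists>f\<in>F. fst e = R (f @ rep C)}"
      proof (rule image_subsetI)
        fix f assume "f \<in> F"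
        with eq[of f] have "\<exists>f'\<in>F. fst e = R (f' @ rep (R (winv f @ u)))" ..
        then show "R (winv f @ u) \<in> {C \<in> range R. \<exists>f\<in>F. fst e = R (f @ rep C)}"
          by (intro CollectI conjI rangeI)
      qed
    qed (simp add: finite_range)
    finally show ?thesis .
  qed
  \<comment> \<open>Double counting: a translate emits on average at least
    \<open>card B * card F / card (range R)\<close> edges of \<open>B\<close>, which is at least
    \<open>2 * card F\<close>.\<close>
  have "(\<Sum>C\<in>range R. card (S C)) = (\<Sum>e\<in>B. card {C \<in> range R. \<exists>f\<in>F. fst e = R (f @ rep C)})"
    unfolding S_def by (rule sum_multicount_gen[OF finite_range fin_B]) simp
  also have "\<dots> \<ge> (\<Sum>e\<in>B. card F)" by (rule sum_mono) (rule count)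
  finally have sum_S: "card B * card F \<le> (\<Sum>C\<in>range R. card (S C))" by simp
  have "\<exists>C\<in>range R. 2 * card F \<le> card (S C)"
  proof (rule ccontr)
    assume "\<not> ?thesis"
    then have "card (S C) < 2 * card F" if "C \<in> range R" for C using that by (meson not_le)
    then have "(\<Sum>C\<in>range R. card (S C)) < (\<Sum>C\<in>range R. 2 * card F)"
      using finite_range by (intro sum_strict_mono) auto
    also have "\<dots> = 2 * card (range R) * card F" by simp
    also have "\<dots> \<le> card B * card F" using B(2) by (rule mult_le_mono1)
    finally show False using sum_S by simp
  qed
  then obtain C where C: "C \<in> range R" "2 * card F \<le> card (S C)" by (rule bexE)
  let ?q = "rep C"
  have fin_S: "finite (S C)" using fin_B by (simp add: S_def)
  have "\<forall>h. \<exists>f. f \<in> cocycles R p \<and> (\<forall>e\<in>B. f e mod int p = h e mod int p)"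
    using ext unfolding Bex_def .
  from choice[OF this] obtain c where "\<forall>h. c h \<in> cocycles R p \<and> (\<forall>e\<in>B. c h e mod int p = h e mod int p)"
    by (elim exE)
  then have c: "c h \<in> cocycles R p" "e \<in> B \<Longrightarrow> c h e mod int p = h e mod int p" for h e
    by simp_all
  \<comment> \<open>The potential of the cocycle \<open>c h\<close>: path sums from the base point
    \<open>?q\<close>, with one value for each \<open>T\<close>-class of \<open>U\<close>.\<close>
  define pot where "pot h = (\<lambda>P\<in>T ` U. psum R (c h) (inv_into UNIV T P) ?q mod int p)" for h
  have pot: "pot h (T u) = psum R (c h) u ?q mod int p" if "u \<in> U" for h u
  proof -
    have "T (inv_into UNIV T (T u)) u" by (simp add: T.R_iff f_inv_into_f)
    from refineD[OF T(2)[OF this] c(1)] show ?thesis using that by (simp add: pot_def)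
  qed
  have "inj_on pot (S C \<rightarrow>\<^sub>E {0..<int p})"
  proof (rule inj_onI)
    fix g h assume g: "g \<in> S C \<rightarrow>\<^sub>E {0..<int p}" and h: "h \<in> S C \<rightarrow>\<^sub>E {0..<int p}" and eq: "pot g = pot h"
    show "g = h"
    proof (rule PiE_ext[OF g h])
      fix e assume e: "e \<in> S C"
      then obtain f x where f: "f \<in> F" and e_eq: "e = (R (f @ ?q), x)" and "e \<in> B"
        by (cases e) (auto simp: S_def)
      \<comment> \<open>An edge label is the difference of the potential at the two ends, so a
        prescription on \<open>S C\<close> can be recovered from its potential.\<close>
      have label: "k e mod int p = (pot k (T (x # f)) - pot k (T f)) mod int p" for k
      proof -
        have "k e mod int p = c k e mod int p" using c(2)[OF \<open>e \<in> B\<close>] by simp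
        also have "c k e = psum R (c k) (x # f) ?q - psum R (c k) f ?q" by (simp add: e_eq)
        also have "\<dots> mod int p = (pot k (T (x # f)) - pot k (T f)) mod int p"
          using f by (subst (1 2) pot) (auto simp: U_def mod_simps)
        finally show ?thesis .
      qed
      have "g e mod int p = h e mod int p" unfolding label eq ..
      then show "g e = h e" using PiE_mem[OF g e] PiE_mem[OF h e] by simp
    qed
  qed
  moreover have "pot h \<in> T ` U \<rightarrow>\<^sub>E {0..<int p}" for h
    using prime_gt_0_nat[OF p] by (auto simp: pot_def)
  moreover have "finite (T ` U \<rightarrow>\<^sub>E {0..<int p})" by (rule finite_PiE) (simp_all add: fin_U)
  ultimately have "card (S C \<rightarrow>\<^sub>E {0..<int p}) \<le> card (T ` U \<rightarrow>\<^sub>E {0..<int p})"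
    by (intro card_inj_on_le[of pot]) auto
  then have "p ^ card (S C) \<le> p ^ card (T ` U)" using fin_S fin_U by (simp add: card_PiE)
  then have "card (S C) \<le> card (T ` U)" using prime_gt_1_nat[OF p] power_le_imp_le_exp by blast
  then show ?thesis using C(2) by (simp add: U_def)
qed

section \<open>The tower and its limit group\<close>

text \<open>Level 0 is the trivial quotient, so the layer between levels \<open>i\<close> and
  \<open>Suc i\<close> belongs to the prime \<open>ps (Suc i)\<close>.\<close>

primrec tower :: "(nat \<Rightarrow> nat) \<Rightarrow> nat \<Rightarrow> word \<Rightarrow> word \<Rightarrow> bool" where
  "tower ps 0 = (\<lambda>u v. True)"
| "tower ps (Suc i) = refine (ps (Suc i)) (tower ps i)"

definition limit :: "(nat \<Rightarrow> nat) \<Rightarrow> word \<Rightarrow> word \<Rightarrow> bool" where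
  "limit ps u v \<longleftrightarrow> (\<forall>i. tower ps i u v)"

lemma tower_antimono: "i \<le> j \<Longrightarrow> tower ps j u v \<Longrightarrow> tower ps i u v"
  by (induction rule: dec_induct) (auto dest: refine_imp)

lemma limit_tower: "limit ps u v \<Longrightarrow> tower ps i u v"
  by (simp add: limit_def)

locale prime_sequence =
  fixes ps :: "nat \<Rightarrow> nat"
  assumes prime_ps: "i \<ge> 1 \<Longrightarrow> Factorial_Ring.prime (ps i)"
begin

lemma finite_congruence_tower: "finite_congruence (tower ps i)"
proof (induction i)
  case 0
  show ?case by unfold_locales (auto intro!: equivpI reflpI sympI transpI)
next
  case (Suc i)
  then interpret finite_congruence "tower ps i" .
  show ?case using finite_congruence_refine[OF prime_gt_0_nat[OF prime_ps[of "Suc i"]]] by simp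
qed

sublocale tower: finite_congruence "tower ps i" for i
  by (rule finite_congruence_tower)

lemma frozen_tower:
  assumes "s \<in> frozen (tower ps i)"
  shows "s \<in> frozen (tower ps (i + k)) \<and> word_ord (tower ps (i + k)) s = word_ord (tower ps i) s"
proof (induction k)
  case (Suc k)
  have "ps (Suc (i + k)) > 0" using prime_gt_0_nat[OF prime_ps[of "Suc (i + k)"]] by simp
  then show ?case using Suc tower.word_ord_refine[of "ps (Suc (i + k))" s "i + k"] by (simp add: frozen_def)
qed (use assms in simp)

text \<open>If \<open>s\<close> freezes at some level, its order is constant from there on.
  Otherwise its orders at all levels are bounded by the threshold \<open>M\<close>, and
  \<open>fact M\<close> is a common multiple of them.\<close>

lemma torsion_congruence_limit: "torsion_congruence (limit ps)"
proof
  show "equivp (limit ps)"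
    by (intro equivpI reflpI sympI transpI)
      (auto simp: limit_def intro: tower.sym tower.trans)
  show "limit ps (u @ v) (u' @ v')" if "limit ps u u'" "limit ps v v'" for u u' v v'
    using that by (simp add: limit_def tower.append)
  fix s
  show "\<exists>n>0. limit ps (wpow n s) []"
  proof (cases "\<exists>i. s \<in> frozen (tower ps i)")
    case True
    then obtain i where i: "s \<in> frozen (tower ps i)" ..
    have "tower ps j (wpow (word_ord (tower ps i) s) s) []" for j
    proof (rule tower_antimono)
      show "tower ps (i + j) (wpow (word_ord (tower ps i) s) s) []"
        using frozen_tower[OF i, of j] tower.word_ord(2)[of "i + j" s] by simp
    qed simp
    then have "limit ps (wpow (word_ord (tower ps i) s) s) []" by (simp add: limit_def)
    then show ?thesis using tower.word_ord(1) by blast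
  next
    case False
    define M :: nat where "M = 2 ^ Suc (to_nat s)"
    have "tower ps i (wpow (fact M) s) []" for i
    proof -
      have "word_ord (tower ps i) s \<le> M" using False by (force simp: frozen_def M_def not_le intro: less_imp_le)
      then have "word_ord (tower ps i) s dvd fact M" using tower.word_ord(1) by (intro dvd_fact) (auto simp: Suc_le_eq)
      then obtain k where "fact M = k * word_ord (tower ps i) s" by (metis dvd_def mult.commute)
      then show ?thesis using tower.wpow_trivial[OF tower.word_ord(2)] by (simp add: wpow_mult)
    qed
    then have "limit ps (wpow (fact M) s) []" by (simp add: limit_def)
    then show ?thesis using fact_gt_zero by blast
  qed
qed

end

section \<open>The group of classes and the kernels of its quotients\<close>

context torsion_congruence
begin

text \<open>The chosen representative depends only on the predicate \<open>R u\<close>, so congruent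
  words share a code. Numbers serve as elements because the theorem asks for a group on the
  naturals.\<close>

definition code :: "word \<Rightarrow> nat" where
  "code u = to_nat (SOME v. R u v)"

definition class_group :: "nat monoid" where
  "class_group = \<lparr>carrier = range code, monoid.mult = \<lambda>m n. code (from_nat m @ from_nat n), one = code []\<rparr>"

lemma from_nat_code: "R u (from_nat (code u))"
  unfolding code_def by (simp add: someI[of "R u" u])

lemma code_eq_iff: "code u = code v \<longleftrightarrow> R u v"
proof
  assume "code u = code v"
  then show "R u v" using from_nat_code[of u] from_nat_code[of v] by (simp add: R_iff)
qed (simp add: code_def R_iff)

lemma code_mult [simp]: "code u \<otimes>\<^bsub>class_group\<^esub> code v = code (u @ v)"
  using append[OF from_nat_code[of u] from_nat_code[of v]]
  by (simp add: class_group_def code_eq_iff R_iff)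

lemma class_group_one: "\<one>\<^bsub>class_group\<^esub> = code []"
  by (simp add: class_group_def)

lemma carrier_class_group: "carrier class_group = range code"
  by (simp add: class_group_def)

lemma group_class_group: "group class_group"
proof (rule groupI)
  fix a assume "a \<in> carrier class_group"
  then obtain u where "a = code u" by (auto simp: carrier_class_group)
  then show "\<exists>b\<in>carrier class_group. b \<otimes>\<^bsub>class_group\<^esub> a = \<one>\<^bsub>class_group\<^esub>"
    using winv_left[of u] by (auto simp: carrier_class_group class_group_one code_eq_iff intro!: bexI[of _ "code (winv u)"])
qed (auto simp: carrier_class_group class_group_one)

sublocale G: group class_group
  by (rule group_class_group)

lemma code_pow: "code u [^]\<^bsub>class_group\<^esub> (n :: nat) = code (wpow n u)"
  by (induction n) (simp_all add: class_group_one wpow_Suc flip: wpow_commute[of 1 u, simplified])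

lemma code_inv: "inv\<^bsub>class_group\<^esub> code u = code (winv u)"
proof (rule G.inv_equality)
  show "code (winv u) \<otimes>\<^bsub>class_group\<^esub> code u = \<one>\<^bsub>class_group\<^esub>"
    using winv_left by (simp add: class_group_one code_eq_iff)
qed (simp_all add: carrier_class_group)

lemma torsion_class_group: "torsion_group class_group"
proof -
  have "\<exists>n>0. code u [^]\<^bsub>class_group\<^esub> (n :: nat) = \<one>\<^bsub>class_group\<^esub>" for u
    using torsion[of u] by (simp add: code_pow class_group_one code_eq_iff)
  then show ?thesis by (auto simp: torsion_group_def G.is_group carrier_class_group)
qed

lemma finitely_generated_class_group: "finitely_generated_group class_group"
proof -
  let ?S = "range (\<lambda>x. code [x])"
  have S: "?S \<subseteq> carrier class_group" by (auto simp: carrier_class_group)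
  have "code u \<in> generate class_group ?S" for u
  proof (induction u)
    case Nil
    then show ?case using generate.one[of class_group ?S] by (simp add: class_group_one)
  next
    case (Cons x u)
    have "code [x] \<otimes>\<^bsub>class_group\<^esub> code u \<in> generate class_group ?S"
      by (intro generate.eng generate.incl Cons) blast
    then show ?case by simp
  qed
  then have "generate class_group ?S = carrier class_group"
    using G.generate_incl[OF S] by (auto simp: carrier_class_group)
  then show ?thesis using S G.is_group unfolding finitely_generated_group_def by (intro conjI exI[of _ ?S]) auto
qed

text \<open>For a congruence \<open>T\<close> coarser than \<open>R\<close>, this is the kernel of
  the projection onto the quotient by \<open>T\<close>.\<close>

definition kernel_of :: "(word \<Rightarrow> word \<Rightarrow> bool) \<Rightarrow> nat set" where
  "kernel_of T = code ` {u. T u []}"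

context
  fixes T
  assumes T: "word_congruence T" and coarser: "\<And>u v. R u v \<Longrightarrow> T u v"
begin

interpretation T: word_congruence T by (rule T)

lemma code_in_kernel_of: "code u \<in> kernel_of T \<longleftrightarrow> T u []"
proof
  assume "code u \<in> kernel_of T"
  then obtain v where v: "code u = code v" "T v []" by (auto simp: kernel_of_def)
  then have "T u v" using coarser by (simp add: code_eq_iff)
  then show "T u []" using v(2) by (rule T.trans)
qed (simp add: kernel_of_def)

lemma kernel_of_normal: "kernel_of T \<lhd> class_group"
proof -
  have inv_mem: "T (winv u) []" if "T u []" for u
    using T.wpow_trivial[OF that] by (simp add: winv_def)
  have "subgroup (kernel_of T) class_group"
  proof (rule G.subgroupI)
    show "kernel_of T \<subseteq> carrier class_group" by (auto simp: kernel_of_def carrier_class_group)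
    show "kernel_of T \<noteq> {}" using code_in_kernel_of[of "[]"] by auto
    show "inv\<^bsub>class_group\<^esub> a \<in> kernel_of T" if "a \<in> kernel_of T" for a
      using that inv_mem by (auto simp: kernel_of_def code_inv)
    show "a \<otimes>\<^bsub>class_group\<^esub> b \<in> kernel_of T" if ab: "a \<in> kernel_of T" "b \<in> kernel_of T" for a b
    proof -
      obtain u v where "a = code u" "b = code v" "T u []" "T v []"
        using ab by (auto simp: kernel_of_def)
      then show ?thesis using T.append[of u "[]" v "[]"] by (simp add: code_in_kernel_of)
    qed
  qed
  moreover have "x \<otimes>\<^bsub>class_group\<^esub> h \<otimes>\<^bsub>class_group\<^esub> inv\<^bsub>class_group\<^esub> x \<in> kernel_of T"
    if xh: "x \<in> carrier class_group" "h \<in> kernel_of T" for x h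
  proof -
    obtain u v where uv: "x = code u" "h = code v" "T v []"
      using xh by (auto simp: kernel_of_def carrier_class_group)
    have "T ((u @ v) @ winv u) ((u @ []) @ winv u)" by (intro T.append T.refl uv(3))
    moreover have "T (u @ winv u) []" by (intro coarser winv_right)
    ultimately have "T ((u @ v) @ winv u) []" by (simp add: T.R_iff)
    then show ?thesis by (simp add: uv code_inv code_in_kernel_of)
  qed
  ultimately show ?thesis by (simp add: G.normal_inv_iff)
qed

lemma kernel_of_coset_eq:
  assumes "T u v"
  shows "kernel_of T #>\<^bsub>class_group\<^esub> code u = kernel_of T #>\<^bsub>class_group\<^esub> code v"
proof -
  \<comment> \<open>\<open>v @ winv u\<close> represents the kernel element that carries
    \<open>u\<close> to \<open>v\<close>.\<close>
  have "T (v @ winv u) (u @ winv u)" by (intro T.append T.refl T.sym[OF assms])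
  moreover have "T (u @ winv u) []" by (intro coarser winv_right)
  ultimately have "code (v @ winv u) \<in> kernel_of T" by (simp add: code_in_kernel_of T.R_iff)
  moreover have "R (v @ []) (v @ winv u @ u)" by (intro append refl sym[OF winv_left])
  then have "code v = code (v @ winv u) \<otimes>\<^bsub>class_group\<^esub> code u" by (simp add: code_eq_iff)
  ultimately have "code v \<in> kernel_of T #>\<^bsub>class_group\<^esub> code u" unfolding r_coset_def by blast
  then show ?thesis
    using kernel_of_normal
    by (intro G.repr_independence) (auto simp: carrier_class_group normal_imp_subgroup)
qed

lemma finite_factor_kernel_of:
  assumes "finite (range T)"
  shows "finite (carrier (class_group Mod kernel_of T))"
proof -
  have "carrier (class_group Mod kernel_of T) = range (\<lambda>u. kernel_of T #>\<^bsub>class_group\<^esub> code u)"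
    by (auto simp: FactGroup_def RCOSETS_def carrier_class_group)
  also have "\<dots> \<subseteq> (\<lambda>P. kernel_of T #>\<^bsub>class_group\<^esub> code (inv_into UNIV T P)) ` range T"
  proof (rule image_subsetI)
    fix u
    have "T u (inv_into UNIV T (T u))" by (simp add: T.R_iff f_inv_into_f)
    then show "kernel_of T #>\<^bsub>class_group\<^esub> code u \<in> (\<lambda>P. kernel_of T #>\<^bsub>class_group\<^esub> code (inv_into UNIV T P)) ` range T"
      by (intro image_eqI[of _ _ "T u"] kernel_of_coset_eq rangeI)
  qed
  finally show ?thesis using assms by (rule finite_surj[rotated])
qed

end

end

text \<open>The order of a nontrivial element divides the prime \<open>p\<close>, hence equals
  \<open>p\<close>, so no smaller positive exponent works.\<close>

lemma (in group) prime_exponent: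
  assumes p: "Factorial_Ring.prime p" and pow: "\<And>x. x \<in> carrier G \<Longrightarrow> x [^] (p :: nat) = \<one>"
  shows "carrier G = {\<one>} \<or> has_exponent G p"
proof (cases "carrier G = {\<one>}")
  case False
  then obtain x where x: "x \<in> carrier G" "x \<noteq> \<one>" by auto
  have "ord x dvd p" using pow[OF x(1)] x(1) by (simp add: pow_eq_id)
  moreover have "ord x \<noteq> 1" using x ord_eq_1[of x] by blast
  ultimately have "ord x = p" using p prime_nat_iff by blast
  then have "p \<le> m" if "m > 0" "\<forall>x\<in>carrier G. x [^] m = \<one>" for m :: nat
    using that x(1) pow_eq_id[OF x(1), of m] by (auto intro: dvd_imp_le)
  then show ?thesis using pow prime_gt_0_nat[OF p] by (auto simp: has_exponent_def)
qed simp

lemma factor_elementary_abelian: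
  fixes G (structure)
  assumes N: "N \<lhd> G" and p: "Factorial_Ring.prime p"
    and comm: "\<And>a b. a \<in> carrier G \<Longrightarrow> b \<in> carrier G \<Longrightarrow> N #> (a \<otimes> b) = N #> (b \<otimes> a)"
    and pow: "\<And>a. a \<in> carrier G \<Longrightarrow> a [^] (p :: nat) \<in> N"
  shows "carrier (G Mod N) = {\<one>\<^bsub>G Mod N\<^esub>} \<or> (comm_group (G Mod N) \<and> has_exponent (G Mod N) p)"
proof -
  interpret normal N G by (rule N)
  interpret Q: group "G Mod N" by (rule factorgroup_is_group)
  have elem: "\<exists>a\<in>carrier G. x = N #> a" if "x \<in> carrier (G Mod N)" for x
    using that by (auto simp: FactGroup_def RCOSETS_def)
  have "x \<otimes>\<^bsub>G Mod N\<^esub> y = y \<otimes>\<^bsub>G Mod N\<^esub> x"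
    if x: "x \<in> carrier (G Mod N)" and y: "y \<in> carrier (G Mod N)" for x y
  proof -
    obtain a b where "a \<in> carrier G" "x = N #> a" "b \<in> carrier G" "y = N #> b"
      using elem[OF x] elem[OF y] by auto
    then show ?thesis using comm by (simp add: FactGroup_def rcos_sum)
  qed
  then have "comm_group (G Mod N)" by (rule Q.group_comm_groupI)
  moreover have "x [^]\<^bsub>G Mod N\<^esub> p = \<one>\<^bsub>G Mod N\<^esub>" if "x \<in> carrier (G Mod N)" for x
  proof -
    obtain a where a: "a \<in> carrier G" "x = N #> a" using elem \<open>x \<in> _\<close> by auto
    then have "x [^]\<^bsub>G Mod N\<^esub> p = N #> (a [^] p)" by (simp add: FactGroup_pow)
    also have "\<dots> = N" using pow[OF a(1)] by (simp add: rcos_const)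
    finally show ?thesis by (simp add: FactGroup_def)
  qed
  ultimately show ?thesis using Q.prime_exponent[OF p] by blast
qed

section \<open>The limit group: its series, non-amenability and primary torsion\<close>

context prime_sequence
begin

sublocale limit: torsion_congruence "limit ps"
  by (rule torsion_congruence_limit)

abbreviation Gr :: "nat monoid" where
  "Gr \<equiv> limit.class_group"

abbreviation N :: "nat \<Rightarrow> nat set" where
  "N i \<equiv> limit.kernel_of (tower ps i)"

lemma word_congruence_tower: "word_congruence (tower ps i)"
  by unfold_locales

lemma N_mem: "limit.code u \<in> N i \<longleftrightarrow> tower ps i u []"
  by (rule limit.code_in_kernel_of[OF word_congruence_tower limit_tower])

lemma N_normal: "N i \<lhd> Gr"
  by (rule limit.kernel_of_normal[OF word_congruence_tower limit_tower])

lemma N_coset_eq: "tower ps i u v \<Longrightarrow> N i #>\<^bsub>Gr\<^esub> limit.code u = N i #>\<^bsub>Gr\<^esub> limit.code v"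
  by (rule limit.kernel_of_coset_eq[OF word_congruence_tower limit_tower])

lemma finite_Mod_N: "finite (carrier (Gr Mod N i))"
  by (rule limit.finite_factor_kernel_of[OF word_congruence_tower limit_tower tower.finite_range])

lemma Inter_N: "(\<Inter>i. N i) = {\<one>\<^bsub>Gr\<^esub>}"
proof -
  have mem: "limit.code u \<in> (\<Inter>i. N i) \<longleftrightarrow> limit.code u = \<one>\<^bsub>Gr\<^esub>" for u
    by (simp add: N_mem limit.class_group_one limit.code_eq_iff limit_def)
  show ?thesis
  proof (intro equalityI subsetI)
    fix x assume x: "x \<in> (\<Inter>i. N i)"
    then obtain u where "x = limit.code u" by (auto simp: limit.kernel_of_def)
    then show "x \<in> {\<one>\<^bsub>Gr\<^esub>}" using x mem by simp
  next
    fix x assume "x \<in> {\<one>\<^bsub>Gr\<^esub>}"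
    then show "x \<in> (\<Inter>i. N i)" using mem[of "[]"] by (simp add: limit.class_group_one)
  qed
qed

lemma tower_wpow: "tower ps i u [] \<Longrightarrow> tower ps (Suc i) (wpow (ps (Suc i)) u) []"
  by (simp add: tower.refine_wpow)

lemma tower_commute: "tower ps i u [] \<Longrightarrow> tower ps i v [] \<Longrightarrow> tower ps (Suc i) (u @ v) (v @ u)"
  by (simp add: tower.refine_commute)

lemma Pi_series_N: "Pi_series ps Gr N"
proof -
  have sub: "N (Suc i) \<subseteq> N i" for i
    using limit_tower by (auto simp: limit.kernel_of_def dest: refine_imp)
  have factor: "carrier (Gr\<lparr>carrier := N i\<rparr> Mod N (Suc i)) = {\<one>\<^bsub>Gr\<lparr>carrier := N i\<rparr> Mod N (Suc i)\<^esub>} \<or>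
      (comm_group (Gr\<lparr>carrier := N i\<rparr> Mod N (Suc i)) \<and> has_exponent (Gr\<lparr>carrier := N i\<rparr> Mod N (Suc i)) (ps (Suc i)))" for i
  proof (rule factor_elementary_abelian)
    show "N (Suc i) \<lhd> Gr\<lparr>carrier := N i\<rparr>"
      by (intro limit.G.normal_restrict_supergroup normal_imp_subgroup N_normal)
        (auto simp: limit.kernel_of_def dest: refine_imp)
    show "Factorial_Ring.prime (ps (Suc i))" by (rule prime_ps) simp
    fix a assume "a \<in> carrier (Gr\<lparr>carrier := N i\<rparr>)"
    then obtain u where u: "a = limit.code u" "tower ps i u []" by (auto simp: limit.kernel_of_def)
    have "a [^]\<^bsub>Gr\<^esub> ps (Suc i) \<in> N (Suc i)"
      using tower_wpow[OF u(2)] by (simp add: u(1) limit.code_pow N_mem del: tower.simps)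
    then show "a [^]\<^bsub>Gr\<lparr>carrier := N i\<rparr>\<^esub> ps (Suc i) \<in> N (Suc i)"
      by (simp add: limit.G.nat_pow_consistent[symmetric] del: tower.simps)
    fix b assume "b \<in> carrier (Gr\<lparr>carrier := N i\<rparr>)"
    then obtain v where v: "b = limit.code v" "tower ps i v []" by (auto simp: limit.kernel_of_def)
    have "N (Suc i) #>\<^bsub>Gr\<^esub> limit.code (u @ v) = N (Suc i) #>\<^bsub>Gr\<^esub> limit.code (v @ u)"
      by (rule N_coset_eq[OF tower_commute[OF u(2) v(2)]])
    then show "N (Suc i) #>\<^bsub>Gr\<lparr>carrier := N i\<rparr>\<^esub> (a \<otimes>\<^bsub>Gr\<lparr>carrier := N i\<rparr>\<^esub> b) =
        N (Suc i) #>\<^bsub>Gr\<lparr>carrier := N i\<rparr>\<^esub> (b \<otimes>\<^bsub>Gr\<lparr>carrier := N i\<rparr>\<^esub> a)"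
      by (simp add: u v r_coset_def del: tower.simps)
  qed
  show ?thesis unfolding Pi_series_def Let_def
  proof (intro conjI allI impI)
    show "N 0 = carrier Gr" by (auto simp: limit.kernel_of_def limit.carrier_class_group)
    show "N i \<lhd> Gr" for i by (rule N_normal)
    fix i :: nat assume "1 \<le> i"
    then have i: "i = Suc (i - 1)" by simp
    show "N i \<subseteq> N (i - 1)" by (subst i) (rule sub)
    show "carrier (Gr\<lparr>carrier := N (i - 1)\<rparr> Mod N i) = {\<one>\<^bsub>Gr\<lparr>carrier := N (i - 1)\<rparr> Mod N i\<^esub>} \<or>
        (comm_group (Gr\<lparr>carrier := N (i - 1)\<rparr> Mod N i) \<and> has_exponent (Gr\<lparr>carrier := N (i - 1)\<rparr> Mod N i) (ps i))"
      using factor[of "i - 1"] unfolding i[symmetric] .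
  qed
qed

lemma not_amenable: "\<not> amenable_group Gr"
proof (rule expanding_not_amenable)
  define Y where "Y = insert (limit.code []) (range (\<lambda>x. limit.code [x]))"
  show "finite Y" "Y \<subseteq> carrier Gr" by (auto simp: Y_def limit.carrier_class_group)
  fix F assume F: "finite F" "F \<subseteq> carrier Gr"
  define W where "W = (from_nat :: nat \<Rightarrow> word) ` F"
  have code_from_nat: "limit.code (from_nat n) = n" if n: "n \<in> F" for n
  proof -
    obtain u where u: "n = limit.code u" using F n by (auto simp: limit.carrier_class_group)
    have "limit ps (from_nat n) u" unfolding u by (rule limit.sym) (rule limit.from_nat_code)
    then show ?thesis by (simp add: u limit.code_eq_iff)
  qed
  have code_W: "limit.code ` W = F" by (simp add: W_def image_image code_from_nat)
  have fin_W: "finite W" using F by (simp add: W_def)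
  have inj_W: "inj_on limit.code W" by (rule inj_onI) (auto simp: W_def code_from_nat)
  \<comment> \<open>Words that differ in the limit differ at some finite level. The maximum over the
    finitely many pairs from \<open>W\<close> gives one level that separates all of
    \<open>W\<close>.\<close>
  have "\<exists>i. \<not> limit ps u v \<longrightarrow> \<not> tower ps i u v" for u v by (auto simp: limit_def)
  then obtain sep where sep: "\<And>u v. \<not> limit ps u v \<Longrightarrow> \<not> tower ps (sep u v) u v" by metis
  define i where "i = Max (insert 0 ((\<lambda>(u, v). sep u v) ` (W \<times> W)))"
  have inj_tower: "inj_on (tower ps i) W"
  proof (rule inj_onI, rule ccontr)
    fix u v assume uv: "u \<in> W" "v \<in> W" "tower ps i u = tower ps i v" "u \<noteq> v"
    have "sep u v \<le> i" unfolding i_def by (rule Max_ge) (use fin_W uv in auto)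
    moreover have "\<not> limit ps u v" using uv inj_W by (auto simp: inj_on_def limit.code_eq_iff)
    ultimately have "\<not> tower ps i u v" using sep tower_antimono by metis
    then show False using uv(3) by (simp add: tower.R_iff)
  qed
  define U where "U = W \<union> (\<Union>x. (#) x ` W)"
  have finer: "refine (ps (Suc i)) (tower ps i) u v" if "limit ps u v" for u v
    using limit_tower[OF that, of "Suc i"] by simp
  have prime: "Factorial_Ring.prime (ps (Suc i))" by (rule prime_ps) simp
  have "2 * card W \<le> card (limit ps ` U)"
    unfolding U_def
    by (rule tower.expansion[OF prime limit.word_congruence_axioms finer fin_W inj_tower])
  \<comment> \<open>A class is recovered from its code, so the number of classes is a lower bound
    for the number of group elements with words in \<open>U\<close>.\<close>
  also have "limit ps ` U = (\<lambda>n. limit ps (from_nat n)) ` limit.code ` U"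
    using limit.from_nat_code by (simp add: image_image limit.R_iff)
  also have "card \<dots> \<le> card (limit.code ` U)"
    by (rule card_image_le) (use fin_W in \<open>auto simp: U_def\<close>)
  also have "limit.code ` U = Y <#>\<^bsub>Gr\<^esub> F"
  proof -
    have "limit.code ` U = limit.code ` W \<union> (\<Union>x. (\<lambda>w. limit.code (x # w)) ` W)"
      by (auto simp: U_def)
    also have "\<dots> = Y <#>\<^bsub>Gr\<^esub> (limit.code ` W)"
      by (auto simp: Y_def set_mult_def)
    finally show ?thesis by (simp add: code_W)
  qed
  finally show "2 * card F \<le> card (Y <#>\<^bsub>Gr\<^esub> F)"
    using card_image[OF inj_W] by (simp add: code_W)
qed (rule limit.group_class_group)

lemma residually_finite: "residually_finite_group Gr"
proof -
  have "\<exists>M. M \<lhd> Gr \<and> finite (carrier (Gr Mod M)) \<and> x \<notin> M" if "x \<noteq> \<one>\<^bsub>Gr\<^esub>" for x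
  proof -
    have "x \<notin> (\<Inter>i. N i)" using that Inter_N by simp
    then obtain i where "x \<notin> N i" by blast
    then show ?thesis using N_normal finite_Mod_N by blast
  qed
  then show ?thesis by (simp add: residually_finite_group_def limit.group_class_group)
qed

text \<open>Level \<open>i\<close> is killed by \<open>p ^ i\<close>. If \<open>m * p ^ k\<close>
  kills \<open>s\<close> and \<open>p\<close> does not divide \<open>m\<close>, then the power
  \<open>t\<close> of \<open>s\<close> is killed by \<open>m\<close> and, at each level, by a power
  of \<open>p\<close>. So \<open>t\<close> is trivial at every level and hence in the limit.\<close>

lemma p_group_const:
  assumes const: "\<And>i. i \<ge> 1 \<Longrightarrow> ps i = p" and p: "Factorial_Ring.prime p"
  shows "p_group p Gr"
proof -
  have trivial: "tower ps i (wpow (p ^ i) s) []" for i s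
  proof (induction i)
    case (Suc i)
    then show ?case using tower.refine_wpow[OF Suc] by (simp add: const wpow_mult)
  qed simp
  have "\<exists>k. limit.G.ord (limit.code s) = p ^ k" for s
  proof -
    obtain n where n: "n > 0" "limit ps (wpow n s) []" using limit.torsion by blast
    obtain k m where m: "\<not> p dvd m" "n = m * p ^ k"
      using prime_power_canonical[OF p n(1)] by blast
    define t where "t = wpow (p ^ k) s"
    have mt: "limit ps (wpow m t) []" using n(2) by (simp add: m(2) t_def wpow_mult)
    have "tower ps i t []" for i
    proof -
      have "coprime m (p ^ i)" using m(1) p by (metis coprime_commute coprime_power_right_iff prime_imp_coprime)
      moreover have "m \<noteq> 0" using m(1) dvd_0_right by metis
      \<comment> \<open>The Bezout identity is taken in the naturals, since only nonnegative powers
        of words are available.\<close>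
      ultimately obtain a b where ab: "a * m = b * p ^ i + 1"
        using bezout_nat[of m "p ^ i"] by (auto simp: mult.commute)
      have "tower ps i (t @ wpow (b * p ^ i) t) (t @ [])"
        unfolding wpow_mult by (intro tower.append tower.refl tower.wpow_trivial trivial)
      then have "tower ps i (wpow (a * m) t) t" by (simp add: ab wpow_Suc)
      moreover have "tower ps i (wpow (a * m) t) []"
        unfolding wpow_mult by (intro tower.wpow_trivial limit_tower mt)
      ultimately show ?thesis by (simp add: tower.R_iff)
    qed
    then have "limit ps t []" by (simp add: limit_def)
    then have "limit.code s [^]\<^bsub>Gr\<^esub> (p ^ k) = \<one>\<^bsub>Gr\<^esub>"
      by (simp add: limit.code_pow t_def limit.class_group_one limit.code_eq_iff)
    then have "limit.G.ord (limit.code s) dvd p ^ k"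
      by (subst (asm) limit.G.pow_eq_id) (simp_all add: limit.carrier_class_group)
    then show ?thesis using divides_primepow_nat[OF p] by blast
  qed
  then show ?thesis by (auto simp: p_group_def limit.group_class_group limit.carrier_class_group)
qed

end

theorem corollary3p2:
  shows "(\<forall>ps :: nat \<Rightarrow> nat. (\<forall>i\<ge>1. Factorial_Ring.prime (ps i)) \<longrightarrow>
            (\<exists>G :: nat monoid. group G \<and> finitely_generated_group G \<and> torsion_group G \<and>
               \<not> amenable_group G \<and> Pi_graded ps G)) \<and>
         (\<forall>p :: nat. Factorial_Ring.prime p \<longrightarrow>
            (\<exists>G :: nat monoid. group G \<and> finitely_generated_group G \<and>
               residually_finite_group G \<and> \<not> amenable_group G \<and> p_group p G))"
proof (intro conjI allI impI)
  fix ps :: "nat \<Rightarrow> nat" assume "\<forall>i\<ge>1. Factorial_Ring.prime (ps i)"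
  then interpret prime_sequence ps by unfold_locales blast
  have "Pi_graded ps Gr"
    using Pi_series_N Inter_N limit.group_class_group unfolding Pi_graded_def by blast
  then show "\<exists>G :: nat monoid. group G \<and> finitely_generated_group G \<and> torsion_group G \<and>
      \<not> amenable_group G \<and> Pi_graded ps G"
    using limit.group_class_group limit.finitely_generated_class_group limit.torsion_class_group
      not_amenable by blast
next
  fix p :: nat assume p: "Factorial_Ring.prime p"
  then interpret prime_sequence "\<lambda>_. p" by unfold_locales
  show "\<exists>G :: nat monoid. group G \<and> finitely_generated_group G \<and>
      residually_finite_group G \<and> \<not> amenable_group G \<and> p_group p G"
    using limit.group_class_group limit.finitely_generated_class_group residually_finite
      not_amenable p_group_const[OF _ p] by blast
qed

end
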